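(* Let $\{\ket{\Phi_b}\}_{b=1}^{2^{n+m}}$ be a stabilizer basis of $\mathcal{H}_n\otimes\mathcal{H}_m$, let $\ket\psi\in\mathcal{H}_m$ be a stabilizer state, and let $\mu_b=(I\otimes\bra\psi)\ket{\Phi_b}\!\bra{\Phi_b}(I\otimes\ket\psi)$. Then there is an integer $0\le\ell\le m$ such that exactly $2^{n+m-\ell}$ of the $\mu_b$ are nonzero, and there is a stabilizer basis $\{\ket{\Psi_c}\}_{c=1}^{2^n}$ of $\mathcal{H}_n$ such that every nonzero element has the form $\mu_b=2^{\ell-m}\ket{\Psi_c}\!\bra{\Psi_c}$ for some $c$; each of these $2^n$ distinct operators occurs exactly $2^{m-\ell}$ times in the POVM.
   Context: $\mathcal{H}_n=(\mathbb{C}^2)^{\otimes n}$ (data qubits), $\mathcal{H}_m=(\mathbb{C}^2)^{\otimes m}$ (ancilla qubits). $\mathcal{P}_k$ is the $k$-qubit Pauli group. A stabilizer state on $k$ qubits is the unique state stabilized by an abelian subgroup of $\mathcal{P}_k$ of order $2^k$ not containing $-I$. A stabilizer basis of $k$ qubits is the orthonormal basis of common eigenvectors of $k$ independent pairwise commuting Pauli operators. *)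

theory Defs
  imports "Jordan_Normal_Form.Matrix"
begin

text \<open>Conventions. A k-qubit state/operator is a complex matrix of dimension 2^k
  (states are column matrices of size 2^k x 1). Tensor products are Kronecker
  products with the standard (big-endian) index convention, so that
  H_n (x) H_m is identified with C^(2^(n+m)), data qubits first.\<close>

definition kron :: "complex mat \<Rightarrow> complex mat \<Rightarrow> complex mat" where
  "kron A B = mat (dim_row A * dim_row B) (dim_col A * dim_col B)
     (\<lambda>(i,j). A $$ (i div dim_row B, j div dim_col B) * B $$ (i mod dim_row B, j mod dim_col B))"

definition dagger :: "complex mat \<Rightarrow> complex mat" where
  "dagger A = mat (dim_col A) (dim_row A) (\<lambda>(i,j). cnj (A $$ (j,i)))"

datatype pauli1 = PI | PX | PY | PZ

fun pmat :: "pauli1 \<Rightarrow> complex mat" where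
  "pmat PI = mat_of_rows_list 2 [[1,0],[0,1]]"
| "pmat PX = mat_of_rows_list 2 [[0,1],[1,0]]"
| "pmat PY = mat_of_rows_list 2 [[0,-\<i>],[\<i>,0]]"
| "pmat PZ = mat_of_rows_list 2 [[1,0],[0,-1]]"

definition pauli_string :: "pauli1 list \<Rightarrow> complex mat" where
  "pauli_string ps = foldr (\<lambda>p M. kron (pmat p) M) ps (1\<^sub>m 1)"

definition pauli_group :: "nat \<Rightarrow> complex mat set" where
  "pauli_group k = {(\<i> ^ c) \<cdot>\<^sub>m pauli_string ps | c ps. length ps = k}"

definition stabilizer_group :: "nat \<Rightarrow> complex mat set \<Rightarrow> bool" where
  "stabilizer_group k S \<longleftrightarrow>
     S \<subseteq> pauli_group k \<and> 1\<^sub>m (2^k) \<in> S \<and>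
     (\<forall>A\<in>S. \<forall>B\<in>S. A * B \<in> S) \<and>
     (\<forall>A\<in>S. \<forall>B\<in>S. A * B = B * A) \<and>
     finite S \<and> card S = 2^k \<and> - (1\<^sub>m (2^k)) \<notin> S"

definition is_state :: "nat \<Rightarrow> complex mat \<Rightarrow> bool" where
  "is_state k \<psi> \<longleftrightarrow> \<psi> \<in> carrier_mat (2^k) 1 \<and> dagger \<psi> * \<psi> = 1\<^sub>m 1"

text \<open>A stabilizer state: a (unit) state stabilized by a stabilizer group
  (such a state is unique up to a global phase).\<close>
definition stabilizer_state :: "nat \<Rightarrow> complex mat \<Rightarrow> bool" where
  "stabilizer_state k \<psi> \<longleftrightarrow> is_state k \<psi> \<and>
     (\<exists>S. stabilizer_group k S \<and> (\<forall>P\<in>S. P * \<psi> = \<psi>))"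

definition prod_gens :: "nat \<Rightarrow> (nat \<Rightarrow> complex mat) \<Rightarrow> nat set \<Rightarrow> complex mat" where
  "prod_gens k g J = foldr (\<lambda>j M. g j * M) (sorted_list_of_set J) (1\<^sub>m (2^k))"

definition independent_paulis :: "nat \<Rightarrow> (nat \<Rightarrow> complex mat) \<Rightarrow> bool" where
  "independent_paulis k g \<longleftrightarrow>
     (\<forall>J. J \<subseteq> {..<k} \<longrightarrow> (\<exists>c. prod_gens k g J = c \<cdot>\<^sub>m 1\<^sub>m (2^k)) \<longrightarrow> J = {})"

definition stabilizer_basis :: "nat \<Rightarrow> (nat \<Rightarrow> complex mat) \<Rightarrow> bool" where
  "stabilizer_basis k \<Phi> \<longleftrightarrow>
     (\<forall>b<2^k. \<Phi> b \<in> carrier_mat (2^k) 1) \<and>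
     (\<forall>b<2^k. \<forall>c<2^k. dagger (\<Phi> b) * \<Phi> c = (if b = c then 1\<^sub>m 1 else 0\<^sub>m 1 1)) \<and>
     (\<exists>g. (\<forall>j<k. g j \<in> pauli_group k) \<and>
          (\<forall>i<k. \<forall>j<k. g i * g j = g j * g i) \<and>
          independent_paulis k g \<and>
          (\<forall>b<2^k. \<forall>j<k. \<exists>e. g j * \<Phi> b = e \<cdot>\<^sub>m \<Phi> b))"

end

theory Submission
  imports Defs "Jordan_Normal_Form.Determinant" "HOL-Library.Function_Algebras"
begin

text \<open>Put \<open>W = I \<otimes> \<langle>\<psi>|\<close> and \<open>\<phi>\<^sub>b = W |\<Phi>\<^sub>b\<rangle>\<close>. Orthogonality of Pauli strings in the Hilbert-Schmidt
  inner product shows that a projector onto a joint eigenvector of \<open>2\<^sup>k\<close> distinct strings on \<open>k\<close>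
  qubits is the signed average of these strings. Applied to \<open>\<psi>\<close>, this gives that every Pauli \<open>q\<close> has
  \<open>\<langle>\<psi>|q|\<psi>\<rangle> = 0\<close> or \<open>\<psi>\<close> as an eigenvector; hence \<open>W (p \<otimes> q)\<close> either dies against \<open>W\<^sup>*\<close> or is
  \<open>\<plusminus> p W\<close>. Applied to the given basis, it writes \<open>\<mu>\<^sub>b = \<phi>\<^sub>b \<phi>\<^sub>b\<^sup>*\<close> as a signed combination of strings that have
  every \<open>\<phi>\<^sub>b\<close> as an eigenvector. So two nonzero \<open>\<phi>\<^sub>b\<close> are parallel or orthogonal, and all have the same
  squared norm \<open>t / 2\<^sup>m\<close>, where \<open>t\<close> counts the surviving strings that restrict to the identity.
  Pairing \<open>\<mu>\<^sub>b\<close> with \<open>\<Sum> \<mu>\<^sub>b = I\<close> shows that each value is taken \<open>2\<^sup>m / t\<close> times, which forces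
  \<open>t = 2\<^sup>\<ell>\<close>. Computing the Hilbert-Schmidt norm of one \<open>\<mu>\<^sub>b\<close> shows that \<open>2\<^sup>n\<close> strings survive, enough
  for \<open>n\<close> independent commuting generators.\<close>

section \<open>Traces, adjoints and Kronecker products\<close>

definition tr :: "complex mat \<Rightarrow> complex" where
  "tr A = (\<Sum>i<dim_row A. A $$ (i, i))"

lemma index_mult_sum:
  assumes "A \<in> carrier_mat r n" "B \<in> carrier_mat n c" "i < r" "j < c"
  shows "(A * B) $$ (i, j) = (\<Sum>k<n. A $$ (i, k) * B $$ (k, j))"
  using assms by (auto simp: scalar_prod_def lessThan_atLeast0 intro!: sum.cong)

lemma tr_mult_commute:
  assumes "A \<in> carrier_mat r c" "B \<in> carrier_mat c r"
  shows "tr (A * B) = tr (B * A)"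
proof -
  have "tr (A * B) = (\<Sum>i<r. \<Sum>k<c. A $$ (i, k) * B $$ (k, i))"
    using assms by (auto simp: tr_def index_mult_sum[OF assms] simp del: index_mult_mat(1) intro!: sum.cong)
  also have "\<dots> = (\<Sum>k<c. \<Sum>i<r. B $$ (k, i) * A $$ (i, k))"
    by (subst sum.swap) (simp add: mult.commute)
  also have "\<dots> = tr (B * A)"
    using assms by (auto simp: tr_def index_mult_sum[OF assms(2,1)] simp del: index_mult_mat(1) intro!: sum.cong)
  finally show ?thesis .
qed

lemma tr_smult: "A \<in> carrier_mat r r \<Longrightarrow> tr (c \<cdot>\<^sub>m A) = c * tr A"
  by (auto simp: tr_def sum_distrib_left intro!: sum.cong)

lemma tr_minus:
  "A \<in> carrier_mat r r \<Longrightarrow> B \<in> carrier_mat r r \<Longrightarrow> tr (A - B) = tr A - tr B"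
  by (auto simp: tr_def sum_subtractf intro!: sum.cong)

lemma tr_one: "tr (1\<^sub>m k) = of_nat k"
  by (simp add: tr_def)

lemma tr_zero: "tr (0\<^sub>m k k) = 0"
  by (simp add: tr_def)

lemma tr_one_dim: "A \<in> carrier_mat 1 1 \<Longrightarrow> A = tr A \<cdot>\<^sub>m 1\<^sub>m 1"
  by (auto simp: tr_def)

lemma dagger_carrier [simp]: "dagger A \<in> carrier_mat r c \<longleftrightarrow> A \<in> carrier_mat c r"
  unfolding carrier_mat_def dagger_def by auto

lemma dagger_dim [simp]: "dim_row (dagger A) = dim_col A" "dim_col (dagger A) = dim_row A"
  by (auto simp: dagger_def)

lemma dagger_index [simp]:
  "i < dim_col A \<Longrightarrow> j < dim_row A \<Longrightarrow> dagger A $$ (i, j) = cnj (A $$ (j, i))"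
  by (auto simp: dagger_def)

lemma dagger_dagger [simp]: "dagger (dagger A) = A"
  by (rule eq_matI) auto

lemma dagger_one [simp]: "dagger (1\<^sub>m k) = 1\<^sub>m k"
  by (rule eq_matI) auto

lemma dagger_smult: "dagger (c \<cdot>\<^sub>m A) = cnj c \<cdot>\<^sub>m dagger A"
  by (rule eq_matI) auto

lemma dagger_minus: "A \<in> carrier_mat r c \<Longrightarrow> B \<in> carrier_mat r c \<Longrightarrow> dagger (A - B) = dagger A - dagger B"
  by (rule eq_matI) auto

lemma dagger_mult:
  assumes "A \<in> carrier_mat r n" "B \<in> carrier_mat n c"
  shows "dagger (A * B) = dagger B * dagger A"
proof (rule eq_matI)
  fix i j assume "i < dim_row (dagger B * dagger A)" "j < dim_col (dagger B * dagger A)"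
  with assms have "i < c" "j < r" by auto
  moreover have "dagger B \<in> carrier_mat c n" "dagger A \<in> carrier_mat n r" using assms by auto
  ultimately show "dagger (A * B) $$ (i, j) = (dagger B * dagger A) $$ (i, j)"
    using assms by (simp add: index_mult_sum[OF assms] index_mult_sum mult.commute
        del: index_mult_mat(1) cong: sum.cong_simp)
qed (use assms in auto)

lemma tr_dagger_mult_self:
  assumes "A \<in> carrier_mat r c"
  shows "tr (dagger A * A) = of_real (\<Sum>i<c. \<Sum>k<r. (cmod (A $$ (k, i)))\<^sup>2)"
proof -
  have d: "dagger A \<in> carrier_mat c r" using assms by simp
  show ?thesis
    using assms by (simp add: tr_def index_mult_sum[OF d assms] complex_norm_square mult.commute
        del: index_mult_mat(1) of_real_power cong: sum.cong_simp)
qed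

text \<open>Definiteness of the Hilbert-Schmidt norm. It turns a computation of traces into an
  equality of matrices.\<close>

lemma tr_dagger_mult_self_eq_0:
  assumes "A \<in> carrier_mat r c" "tr (dagger A * A) = 0"
  shows "A = 0\<^sub>m r c"
proof -
  have "(\<Sum>i<c. \<Sum>k<r. (cmod (A $$ (k, i)))\<^sup>2) = 0"
    using assms(2) unfolding tr_dagger_mult_self[OF assms(1)] of_real_eq_0_iff .
  then have "\<forall>i<c. \<forall>k<r. A $$ (k, i) = 0"
    by (simp add: sum_nonneg_eq_0_iff sum_nonneg)
  then show ?thesis using assms(1) by auto
qed

lemma mat_smult_smult: "a \<cdot>\<^sub>m (b \<cdot>\<^sub>m A) = (a * b) \<cdot>\<^sub>m (A :: complex mat)"
  by (rule eq_matI) auto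

lemma mat_smult_one: "1 \<cdot>\<^sub>m A = (A :: complex mat)"
  by (rule eq_matI) auto

lemma div_mod_less:
  fixes i :: nat
  assumes "i < a * b"
  shows "i div b < a" "i mod b < b"
proof -
  have "0 < b" using assms by (cases b) auto
  then show "i div b < a" "i mod b < b" using assms by (auto simp: less_mult_imp_div_less)
qed

lemma sum_div_mod:
  fixes f :: "nat \<Rightarrow> nat \<Rightarrow> 'a::comm_monoid_add"
  shows "(\<Sum>k<a * b. f (k div b) (k mod b)) = (\<Sum>x<a. \<Sum>y<b. f x y)"
proof -
  have encode: "x * b + y < a * b" if "x < a" "y < b" for x y
  proof -
    have "x * b + y < Suc x * b" using that by simp
    also have "\<dots> \<le> a * b" using that by (intro mult_le_mono1) simp
    finally show ?thesis .
  qed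
  have "(\<Sum>x<a. \<Sum>y<b. f x y) = (\<Sum>(x, y)\<in>{..<a} \<times> {..<b}. f x y)"
    by (simp add: sum.cartesian_product)
  also have "\<dots> = (\<Sum>k<a * b. f (k div b) (k mod b))"
    by (rule sum.reindex_bij_witness[where i = "\<lambda>k. (k div b, k mod b)" and j = "\<lambda>(x, y). x * b + y"])
      (auto simp: div_mod_less encode)
  finally show ?thesis by simp
qed

lemma kron_carrier [simp]:
  "A \<in> carrier_mat r c \<Longrightarrow> B \<in> carrier_mat r' c' \<Longrightarrow> kron A B \<in> carrier_mat (r * r') (c * c')"
  by (auto simp: kron_def)

lemma kron_dim [simp]:
  "dim_row (kron A B) = dim_row A * dim_row B" "dim_col (kron A B) = dim_col A * dim_col B"
  by (auto simp: kron_def)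

lemma kron_index:
  "i < dim_row A * dim_row B \<Longrightarrow> j < dim_col A * dim_col B \<Longrightarrow>
   kron A B $$ (i, j) = A $$ (i div dim_row B, j div dim_col B) * B $$ (i mod dim_row B, j mod dim_col B)"
  by (simp add: kron_def)

text \<open>The sum over the inner index splits into its two digits by \<open>sum_div_mod\<close>
  and factors into one sum per tensor leg.\<close>

lemma kron_mult:
  assumes "A \<in> carrier_mat r1 k1" "C \<in> carrier_mat k1 c1"
    and "B \<in> carrier_mat r2 k2" "D \<in> carrier_mat k2 c2"
  shows "kron A B * kron C D = kron (A * C) (B * D)"
proof (rule eq_matI)
  fix i j assume "i < dim_row (kron (A * C) (B * D))" "j < dim_col (kron (A * C) (B * D))"
  then have ij: "i < r1 * r2" "j < c1 * c2" using assms by auto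
  note dm = div_mod_less[OF ij(1)] div_mod_less[OF ij(2)]
  have "(kron A B * kron C D) $$ (i, j) = (\<Sum>k<k1 * k2. kron A B $$ (i, k) * kron C D $$ (k, j))"
    by (rule index_mult_sum[OF kron_carrier[OF assms(1,3)] kron_carrier[OF assms(2,4)] ij])
  also have "\<dots> = (\<Sum>k<k1 * k2. (\<lambda>x y. (A $$ (i div r2, x) * C $$ (x, j div c2)) *
      (B $$ (i mod r2, y) * D $$ (y, j mod c2))) (k div k2) (k mod k2))"
    using assms ij by (intro sum.cong) (auto simp: kron_index)
  also have "\<dots> = (\<Sum>x<k1. A $$ (i div r2, x) * C $$ (x, j div c2)) *
      (\<Sum>y<k2. B $$ (i mod r2, y) * D $$ (y, j mod c2))"
    by (subst sum_div_mod) (simp add: sum_product)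
  also have "\<dots> = kron (A * C) (B * D) $$ (i, j)"
    using assms ij
    by (simp add: kron_index index_mult_sum[OF assms(1,2) dm(1,3)] index_mult_sum[OF assms(3,4) dm(2,4)]
        del: index_mult_mat(1))
  finally show "(kron A B * kron C D) $$ (i, j) = kron (A * C) (B * D) $$ (i, j)" .
qed (use assms in auto)

lemma tr_kron:
  assumes "A \<in> carrier_mat a a" "B \<in> carrier_mat b b"
  shows "tr (kron A B) = tr A * tr B"
proof -
  have "tr (kron A B) = (\<Sum>k<a * b. (\<lambda>x y. A $$ (x, x) * B $$ (y, y)) (k div b) (k mod b))"
    using assms by (auto simp: tr_def kron_index intro!: sum.cong)
  also have "\<dots> = tr A * tr B"
    using assms by (subst sum_div_mod) (auto simp: tr_def sum_product)
  finally show ?thesis .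
qed

lemma dagger_kron: "dagger (kron A B) = kron (dagger A) (dagger B)"
  by (rule eq_matI) (auto simp: kron_index div_mod_less)

lemma kron_assoc: "kron (kron A B) C = kron A (kron B C)"
proof -
  \<comment> \<open>The three digits of \<open>i\<close> in mixed radix do not depend on which of
    them is split off first.\<close>
  have dm: "i div c div b = i div (b * c)" "i div c mod b = i mod (b * c) div c"
    "i mod (b * c) mod c = i mod c" if "i < a * (b * c)" for i a b c :: nat
  proof -
    show "i div c div b = i div (b * c)" by (subst mult.commute) (rule div_mult2_eq[symmetric])
    have "i mod (b * c) = c * (i div c mod b) + i mod c"
      by (subst mult.commute) (rule mod_mult2_eq)
    moreover have "i mod c < c" using that by (cases c) auto
    ultimately show "i div c mod b = i mod (b * c) div c" by simp
    show "i mod (b * c) mod c = i mod c" by (simp add: mod_mod_cancel)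
  qed
  show ?thesis
    by (rule eq_matI) (auto simp: kron_index div_mod_less dm mult.assoc)
qed

lemma kron_one_one: "kron (1\<^sub>m a) (1\<^sub>m b) = 1\<^sub>m (a * b)"
proof (rule eq_matI)
  fix i j assume ij: "i < dim_row (1\<^sub>m (a * b) :: complex mat)" "j < dim_col (1\<^sub>m (a * b) :: complex mat)"
  have "i = j \<longleftrightarrow> i div b = j div b \<and> i mod b = j mod b"
    by (metis div_mult_mod_eq)
  then show "kron (1\<^sub>m a) (1\<^sub>m b) $$ (i, j) = 1\<^sub>m (a * b) $$ (i, j)"
    using ij by (auto simp: kron_index div_mod_less)
qed auto

lemma kron_one_left: "kron (1\<^sub>m 1) A = A"
  by (rule eq_matI) (auto simp: kron_index)

lemma kron_one_right: "kron A (1\<^sub>m 1) = A"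
  by (rule eq_matI) (auto simp: kron_index)

lemma kron_smult_left: "kron (c \<cdot>\<^sub>m A) B = c \<cdot>\<^sub>m kron A B"
  by (rule eq_matI) (auto simp: kron_index div_mod_less)

lemma kron_smult_right: "kron A (c \<cdot>\<^sub>m B) = c \<cdot>\<^sub>m kron A B"
  by (rule eq_matI) (auto simp: kron_index div_mod_less)

lemma kron_zero_right: "kron A (0\<^sub>m r c) = 0\<^sub>m (dim_row A * r) (dim_col A * c)"
  by (rule eq_matI) (auto simp: kron_index div_mod_less)

section \<open>Pauli strings\<close>

text \<open>Pauli matrices modulo phase form the Klein four-group. The instance provides finite sums
  of labels and, through pointwise addition of functions, the group of Pauli strings modulo
  phase.\<close>

instantiation pauli1 :: comm_monoid_add
begin

fun plus_pauli1 :: "pauli1 \<Rightarrow> pauli1 \<Rightarrow> pauli1" where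
  "PI + q = q"
| "p + PI = p"
| "PX + PX = PI" | "PX + PY = PZ" | "PX + PZ = PY"
| "PY + PX = PZ" | "PY + PY = PI" | "PY + PZ = PX"
| "PZ + PX = PY" | "PZ + PY = PX" | "PZ + PZ = PI"

definition zero_pauli1 :: pauli1 where "0 = PI"

instance
proof
  fix p q r :: pauli1
  show "p + q + r = p + (q + r)" by (cases p; cases q; cases r) simp_all
  show "p + q = q + p" by (cases p; cases q) simp_all
  show "0 + p = p" by (simp add: zero_pauli1_def)
qed

end

lemma pauli1_double: "p + p = (0::pauli1)"
  by (cases p) (simp_all add: zero_pauli1_def)

lemma pauli1_add_eq_0: "p + q = (0::pauli1) \<longleftrightarrow> p = q"
  by (cases p; cases q) (simp_all add: zero_pauli1_def)

lemma pmat_carrier [simp]: "pmat p \<in> carrier_mat 2 2"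
  unfolding carrier_mat_def by (cases p) (auto simp: mat_of_rows_list_def)

lemma pmat_entries:
  "pmat PI $$ (0,0) = 1" "pmat PI $$ (0,Suc 0) = 0" "pmat PI $$ (Suc 0,0) = 0" "pmat PI $$ (Suc 0,Suc 0) = 1"
  "pmat PX $$ (0,0) = 0" "pmat PX $$ (0,Suc 0) = 1" "pmat PX $$ (Suc 0,0) = 1" "pmat PX $$ (Suc 0,Suc 0) = 0"
  "pmat PY $$ (0,0) = 0" "pmat PY $$ (0,Suc 0) = -\<i>" "pmat PY $$ (Suc 0,0) = \<i>" "pmat PY $$ (Suc 0,Suc 0) = 0"
  "pmat PZ $$ (0,0) = 1" "pmat PZ $$ (0,Suc 0) = 0" "pmat PZ $$ (Suc 0,0) = 0" "pmat PZ $$ (Suc 0,Suc 0) = -1"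
  by (simp_all add: mat_of_rows_list_def)

lemma eq_mat_2:
  assumes "A \<in> carrier_mat 2 2" "B \<in> carrier_mat 2 2"
    and "A $$ (0,0) = B $$ (0,0)" "A $$ (0,Suc 0) = B $$ (0,Suc 0)"
    and "A $$ (Suc 0,0) = B $$ (Suc 0,0)" "A $$ (Suc 0,Suc 0) = B $$ (Suc 0,Suc 0)"
  shows "A = B"
  by (rule eq_matI) (use assms in \<open>auto simp: less_2_cases_iff\<close>)

lemma pmat_one: "pmat 0 = 1\<^sub>m 2"
  unfolding zero_pauli1_def by (rule eq_mat_2) (simp_all add: pmat_entries del: pmat.simps)

lemma pmat_dagger: "dagger (pmat p) = pmat p"
proof -
  have "pmat p \<in> carrier_mat 2 2" by simp
  then have "dim_row (pmat p) = 2" "dim_col (pmat p) = 2" by blast+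
  then show ?thesis
    by (intro eq_mat_2; cases p) (simp_all add: pmat_entries del: pmat.simps)
qed

lemma tr_pmat: "tr (pmat p) = (if p = 0 then 2 else 0)"
proof -
  have "dim_row (pmat p) = 2" using pmat_carrier[of p] by blast
  then show ?thesis
    by (cases p) (simp_all add: tr_def zero_pauli1_def pmat_entries numeral_2_eq_2 del: pmat.simps)
qed

lemma pmat_mult_carrier [simp]: "pmat p * pmat q \<in> carrier_mat 2 2"
  by (rule mult_carrier_mat[OF pmat_carrier pmat_carrier])

lemma pmat_mult_index:
  "i < 2 \<Longrightarrow> j < 2 \<Longrightarrow> (pmat p * pmat q) $$ (i, j) =
    pmat p $$ (i, 0) * pmat q $$ (0, j) + pmat p $$ (i, Suc 0) * pmat q $$ (Suc 0, j)"
  using index_mult_sum[OF pmat_carrier pmat_carrier, of i j p q]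
  by (simp add: numeral_2_eq_2 del: pmat.simps index_mult_mat(1))

lemma pmat_square: "pmat p * pmat p = 1\<^sub>m 2"
  by (rule eq_mat_2; cases p)
    (simp_all add: pmat_mult_index pmat_entries del: pmat.simps index_mult_mat(1))

lemma pmat_mult: "\<exists>c::nat. pmat p * pmat q = \<i> ^ c \<cdot>\<^sub>m pmat (p + q)"
proof -
  \<comment> \<open>\<open>XY = iZ\<close> holds cyclically, the reversed order gives
    \<open>-i\<close>, the third power of \<open>\<i>\<close>, and equal factors or a factor
    \<open>PI\<close> give phase one.\<close>
  define c :: nat where "c = (if (p, q) \<in> {(PX, PY), (PY, PZ), (PZ, PX)} then 1
    else if (p, q) \<in> {(PY, PX), (PZ, PY), (PX, PZ)} then 3 else 0)"
  have dim: "dim_row (pmat r) = 2" "dim_col (pmat r) = 2" for r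
    using pmat_carrier[of r] by blast+
  have "pmat p * pmat q = \<i> ^ c \<cdot>\<^sub>m pmat (p + q)"
    by (rule eq_mat_2; cases p; cases q)
      (simp_all add: dim c_def pmat_mult_index pmat_entries power3_eq_cube del: pmat.simps index_mult_mat(1))
  then show ?thesis ..
qed

text \<open>A label is a function rather than a list, so that labels add pointwise and can be summed
  over finite sets. Only its values below \<open>k\<close> matter, hence equality of strings appears
  below as agreement for all \<open>i < k\<close>.\<close>

definition pstr :: "nat \<Rightarrow> (nat \<Rightarrow> pauli1) \<Rightarrow> complex mat" where
  "pstr k a = pauli_string (map a [0..<k])"

lemma pstr_0: "pstr 0 a = 1\<^sub>m 1"
  by (simp add: pstr_def pauli_string_def)

lemma pstr_Suc: "pstr (Suc k) a = kron (pmat (a 0)) (pstr k (\<lambda>i. a (Suc i)))"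
  by (simp add: pstr_def pauli_string_def map_upt_Suc del: upt_Suc)

lemma pstr_cong: "(\<And>i. i < k \<Longrightarrow> a i = b i) \<Longrightarrow> pstr k a = pstr k b"
  unfolding pstr_def by (metis (mono_tags, lifting) atLeastLessThan_iff map_cong set_upt)

lemma pstr_carrier [simp]: "pstr k a \<in> carrier_mat (2 ^ k) (2 ^ k)"
proof (induction k arbitrary: a)
  case (Suc k)
  show ?case using kron_carrier[OF pmat_carrier Suc] by (simp add: pstr_Suc)
qed (simp add: pstr_0)

lemma pstr_dim [simp]: "dim_row (pstr k a) = 2 ^ k" "dim_col (pstr k a) = 2 ^ k"
  using pstr_carrier[of k a] by blast+

lemma pauli_group_iff: "P \<in> pauli_group k \<longleftrightarrow> (\<exists>c a. P = \<i> ^ c \<cdot>\<^sub>m pstr k a)"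
proof
  assume "P \<in> pauli_group k"
  then obtain c ps where "length ps = k" "P = \<i> ^ c \<cdot>\<^sub>m pauli_string ps"
    by (auto simp: pauli_group_def)
  then have "P = \<i> ^ c \<cdot>\<^sub>m pstr k (\<lambda>i. ps ! i)"
    by (auto simp: pstr_def map_nth)
  then show "\<exists>c a. P = \<i> ^ c \<cdot>\<^sub>m pstr k a" by blast
next
  assume "\<exists>c a. P = \<i> ^ c \<cdot>\<^sub>m pstr k a"
  then obtain c a where "P = \<i> ^ c \<cdot>\<^sub>m pauli_string (map a [0..<k])"
    by (auto simp: pstr_def)
  moreover have "length (map a [0..<k]) = k" by simp
  ultimately show "P \<in> pauli_group k" unfolding pauli_group_def by blast
qed

lemma pstr_zero: "pstr k (\<lambda>_. 0) = 1\<^sub>m (2 ^ k)"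
  by (induction k) (simp_all add: pstr_0 pstr_Suc pmat_one kron_one_one)

lemma pstr_add: "pstr (n + m) a = kron (pstr n a) (pstr m (\<lambda>i. a (n + i)))"
  by (induction n arbitrary: a) (simp_all add: pstr_0 kron_one_left pstr_Suc kron_assoc del: One_nat_def)

lemma pstr_dagger: "dagger (pstr k a) = pstr k a"
  by (induction k arbitrary: a) (simp_all add: pstr_0 pstr_Suc dagger_kron pmat_dagger)

lemma pstr_square: "pstr k a * pstr k a = 1\<^sub>m (2 ^ k)"
  by (induction k arbitrary: a)
    (simp_all add: pstr_0 pstr_Suc pmat_square kron_one_one
      kron_mult[OF pmat_carrier pmat_carrier pstr_carrier pstr_carrier])

lemma pstr_mult: "\<exists>c::nat. pstr k a * pstr k b = \<i> ^ c \<cdot>\<^sub>m pstr k (\<lambda>i. a i + b i)"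
proof (induction k arbitrary: a b)
  case 0
  have "pstr 0 a * pstr 0 b = \<i> ^ 0 \<cdot>\<^sub>m pstr 0 (\<lambda>i. a i + b i)" by (simp add: pstr_0 mat_smult_one)
  then show ?case ..
next
  case (Suc k)
  obtain c where c: "pmat (a 0) * pmat (b 0) = \<i> ^ c \<cdot>\<^sub>m pmat (a 0 + b 0)" using pmat_mult by blast
  obtain d where d: "pstr k (\<lambda>i. a (Suc i)) * pstr k (\<lambda>i. b (Suc i)) =
      \<i> ^ d \<cdot>\<^sub>m pstr k (\<lambda>i. a (Suc i) + b (Suc i))"
    using Suc by blast
  have "pstr (Suc k) a * pstr (Suc k) b = \<i> ^ (c + d) \<cdot>\<^sub>m pstr (Suc k) (\<lambda>i. a i + b i)"
    by (simp add: pstr_Suc kron_mult[OF pmat_carrier pmat_carrier pstr_carrier pstr_carrier] c d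
        kron_smult_left kron_smult_right mat_smult_smult power_add mult.commute)
  then show ?case ..
qed

lemma tr_pstr: "tr (pstr k a) = (if \<forall>i<k. a i = 0 then 2 ^ k else 0)"
  by (induction k arbitrary: a)
    (auto simp: pstr_0 tr_one pstr_Suc tr_kron[OF pmat_carrier pstr_carrier] tr_pmat All_less_Suc2)

text \<open>The product is a phase times the string of the summed label. That label vanishes exactly
  where the two agree, and every nonidentity string is traceless. As strings are Hermitian, this is
  their orthogonality in the Hilbert-Schmidt product.\<close>

lemma tr_pstr_mult:
  "tr (pstr k a * pstr k b) = (if \<forall>i<k. a i = b i then 2 ^ k else 0)"
proof (cases "\<forall>i<k. a i = b i")
  case True
  then have "pstr k b = pstr k a" using pstr_cong[of k b a] by simp
  then show ?thesis using True by (simp add: pstr_square tr_one)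
next
  case False
  obtain c where "pstr k a * pstr k b = \<i> ^ c \<cdot>\<^sub>m pstr k (\<lambda>i. a i + b i)" using pstr_mult by blast
  then have "tr (pstr k a * pstr k b) = 0" using False
    by (auto simp: tr_smult[OF pstr_carrier] tr_pstr pauli1_add_eq_0)
  then show ?thesis unfolding if_not_P[OF False] .
qed

text \<open>Strings that differ somewhere are orthogonal, so pairing with \<open>pstr k b\<close>
  forces \<open>z = 0\<close>; but a string squares to the identity and cannot vanish.\<close>

lemma pstr_eq_smultD:
  assumes "pstr k a = z \<cdot>\<^sub>m pstr k b" "i < k"
  shows "a i = b i"
proof (rule ccontr)
  assume "a i \<noteq> b i"
  then have "tr (pstr k b * pstr k a) = 0" using assms(2) by (auto simp: tr_pstr_mult)
  then have "z * 2 ^ k = 0"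
    unfolding assms(1) mult_smult_distrib[OF pstr_carrier pstr_carrier]
    by (simp add: tr_smult[OF mult_carrier_mat[OF pstr_carrier pstr_carrier]] tr_pstr_mult)
  then have "z = 0" by simp
  then have "tr (pstr k a * pstr k a) = 0"
    unfolding assms(1) mult_smult_distrib[OF smult_carrier_mat[OF pstr_carrier] pstr_carrier]
    using tr_smult[OF mult_carrier_mat[OF smult_carrier_mat[OF pstr_carrier] pstr_carrier]] by simp
  then show False by (simp add: tr_pstr_mult)
qed

lemma smult_cancel_nonzero:
  fixes v :: "complex mat"
  assumes "v \<in> carrier_mat d 1" "v \<noteq> 0\<^sub>m d 1" "z \<cdot>\<^sub>m v = w \<cdot>\<^sub>m v"
  shows "z = w"
proof -
  obtain i where i: "i < d" "v $$ (i, 0) \<noteq> 0"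
    using assms(1,2) by (metis (no_types, lifting) carrier_matD eq_matI index_zero_mat less_one)
  have "(z \<cdot>\<^sub>m v) $$ (i, 0) = (w \<cdot>\<^sub>m v) $$ (i, 0)" using assms(3) by simp
  then show ?thesis using i assms(1) by simp
qed

text \<open>A string squares to the identity, so its eigenvalues are signs; in particular they are
  real.\<close>

lemma pstr_eigenvalue_square:
  assumes "v \<in> carrier_mat (2 ^ k) 1" "v \<noteq> 0\<^sub>m (2 ^ k) 1" "pstr k a * v = z \<cdot>\<^sub>m v"
  shows "z * z = 1"
proof -
  have "1 \<cdot>\<^sub>m v = pstr k a * (pstr k a * v)"
    using assms(1)
    by (simp add: pstr_square mat_smult_one flip: assoc_mult_mat[OF pstr_carrier pstr_carrier assms(1)])
  also have "\<dots> = (z * z) \<cdot>\<^sub>m v"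
    by (simp add: assms(3) mult_smult_distrib[OF pstr_carrier assms(1)] mat_smult_smult)
  finally show ?thesis using smult_cancel_nonzero[OF assms(1,2)] by metis
qed

lemma cnj_sign: "z * z = 1 \<Longrightarrow> cnj z = (z::complex)"
  by (auto simp: square_eq_1_iff)

section \<open>Finite sums of matrices\<close>

definition msum :: "nat \<Rightarrow> nat \<Rightarrow> ('a \<Rightarrow> complex mat) \<Rightarrow> 'a set \<Rightarrow> complex mat" where
  "msum r c f I = mat r c (\<lambda>(i, j). \<Sum>x\<in>I. f x $$ (i, j))"

lemma msum_carrier [simp]: "msum r c f I \<in> carrier_mat r c"
  by (simp add: msum_def)

lemma msum_cong: "(\<And>x. x \<in> I \<Longrightarrow> f x = g x) \<Longrightarrow> msum r c f I = msum r c g I"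
  by (simp add: msum_def cong: sum.cong)

lemma msum_smult_const:
  "A \<in> carrier_mat r c \<Longrightarrow> msum r c (\<lambda>x. z x \<cdot>\<^sub>m A) I = (\<Sum>x\<in>I. z x) \<cdot>\<^sub>m A"
  by (rule eq_matI) (auto simp: msum_def sum_distrib_right)

lemma mult_msum:
  assumes "A \<in> carrier_mat r n" "\<And>x. x \<in> I \<Longrightarrow> f x \<in> carrier_mat n c"
  shows "A * msum n c f I = msum r c (\<lambda>x. A * f x) I"
proof (rule eq_matI)
  fix i j assume "i < dim_row (msum r c (\<lambda>x. A * f x) I)" "j < dim_col (msum r c (\<lambda>x. A * f x) I)"
  then have ij: "i < r" "j < c" by (simp_all add: msum_def)
  have "(A * msum n c f I) $$ (i, j) = (\<Sum>k<n. \<Sum>x\<in>I. A $$ (i, k) * f x $$ (k, j))"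
    using ij unfolding index_mult_sum[OF assms(1) msum_carrier ij]
    by (simp add: msum_def sum_distrib_left)
  also have "\<dots> = (\<Sum>x\<in>I. (A * f x) $$ (i, j))"
    by (subst sum.swap) (intro sum.cong refl index_mult_sum[OF assms ij, symmetric])
  finally show "(A * msum n c f I) $$ (i, j) = msum r c (\<lambda>x. A * f x) I $$ (i, j)"
    using ij by (simp add: msum_def)
qed (use assms in \<open>auto simp: msum_def\<close>)

lemma msum_mult:
  assumes "\<And>x. x \<in> I \<Longrightarrow> f x \<in> carrier_mat r n" "B \<in> carrier_mat n c"
  shows "msum r n f I * B = msum r c (\<lambda>x. f x * B) I"
proof (rule eq_matI)
  fix i j assume "i < dim_row (msum r c (\<lambda>x. f x * B) I)" "j < dim_col (msum r c (\<lambda>x. f x * B) I)"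
  then have ij: "i < r" "j < c" by (simp_all add: msum_def)
  have "(msum r n f I * B) $$ (i, j) = (\<Sum>k<n. \<Sum>x\<in>I. f x $$ (i, k) * B $$ (k, j))"
    using ij unfolding index_mult_sum[OF msum_carrier assms(2) ij]
    by (simp add: msum_def sum_distrib_right)
  also have "\<dots> = (\<Sum>x\<in>I. (f x * B) $$ (i, j))"
    by (subst sum.swap) (intro sum.cong refl index_mult_sum[OF assms ij, symmetric])
  finally show "(msum r n f I * B) $$ (i, j) = msum r c (\<lambda>x. f x * B) I $$ (i, j)"
    using ij by (simp add: msum_def)
qed (use assms in \<open>auto simp: msum_def\<close>)

lemma tr_msum:
  assumes "\<And>x. x \<in> I \<Longrightarrow> f x \<in> carrier_mat r r"
  shows "tr (msum r r f I) = (\<Sum>x\<in>I. tr (f x))"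
proof -
  have "tr (msum r r f I) = (\<Sum>i<r. \<Sum>x\<in>I. f x $$ (i, i))"
    by (simp add: tr_def msum_def)
  also have "\<dots> = (\<Sum>x\<in>I. tr (f x))"
    using assms by (subst sum.swap) (auto simp: tr_def intro!: sum.cong)
  finally show ?thesis .
qed

lemma dagger_msum:
  assumes "\<And>x. x \<in> I \<Longrightarrow> f x \<in> carrier_mat r c"
  shows "dagger (msum r c f I) = msum c r (\<lambda>x. dagger (f x)) I"
proof (rule eq_matI)
  fix i j assume "i < dim_row (msum c r (\<lambda>x. dagger (f x)) I)" "j < dim_col (msum c r (\<lambda>x. dagger (f x)) I)"
  then have ij: "i < c" "j < r" by (simp_all add: msum_def)
  have "cnj (f x $$ (j, i)) = dagger (f x) $$ (i, j)" if "x \<in> I" for x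
    using assms[OF that] ij by auto
  then show "dagger (msum r c f I) $$ (i, j) = msum c r (\<lambda>x. dagger (f x)) I $$ (i, j)"
    using ij by (simp add: msum_def)
qed (simp_all add: msum_def)

text \<open>The Hilbert-Schmidt pairing of a matrix with a Pauli expansion is evaluated through this
  formula.\<close>

lemma tr_mult_smult_msum:
  assumes "M \<in> carrier_mat d d" "\<And>x. x \<in> I \<Longrightarrow> p x \<in> carrier_mat d d"
  shows "tr (M * (c \<cdot>\<^sub>m msum d d (\<lambda>x. e x \<cdot>\<^sub>m p x) I)) = c * (\<Sum>x\<in>I. e x * tr (M * p x))"
proof -
  have "M * (c \<cdot>\<^sub>m msum d d (\<lambda>x. e x \<cdot>\<^sub>m p x) I) = c \<cdot>\<^sub>m msum d d (\<lambda>x. M * (e x \<cdot>\<^sub>m p x)) I"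
    using assms by (simp add: mult_smult_distrib[OF _ msum_carrier] mult_msum[OF assms(1)])
  also have "\<dots> = c \<cdot>\<^sub>m msum d d (\<lambda>x. e x \<cdot>\<^sub>m (M * p x)) I"
    using assms by (auto intro!: arg_cong[where f = "(\<cdot>\<^sub>m) c"] msum_cong mult_smult_distrib)
  finally show ?thesis
    using assms by (simp add: tr_smult[OF msum_carrier] tr_msum mult_carrier_mat[of _ d d]
        tr_smult[of _ d] del: index_mult_mat cong: sum.cong_simp)
qed

section \<open>Rank-one projectors and stabilizer states\<close>

lemma unit_outer_projector:
  assumes v: "v \<in> carrier_mat d 1" "dagger v * v = 1\<^sub>m 1"
  shows "v * dagger v \<in> carrier_mat d d" "dagger (v * dagger v) = v * dagger v"
    "v * dagger v * (v * dagger v) = v * dagger v" "tr (v * dagger v) = 1"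
proof -
  have dv: "dagger v \<in> carrier_mat 1 d" using v(1) by simp
  show "v * dagger v \<in> carrier_mat d d" using v(1) dv by (rule mult_carrier_mat)
  show "dagger (v * dagger v) = v * dagger v" using dagger_mult[OF v(1) dv] by simp
  have "dagger v * (v * dagger v) = dagger v * v * dagger v"
    by (rule assoc_mult_mat[OF dv v(1) dv, symmetric])
  also have "\<dots> = dagger v" using v(2) left_mult_one_mat[OF dv] by simp
  finally show "v * dagger v * (v * dagger v) = v * dagger v"
    using assoc_mult_mat[OF v(1) dv mult_carrier_mat[OF v(1) dv]] by simp
  show "tr (v * dagger v) = 1" using tr_mult_commute[OF v(1) dv] v(2) by (simp add: tr_one)
qed

lemma unit_nonzero:
  assumes "v \<in> carrier_mat d 1" "dagger v * v = 1\<^sub>m 1"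
  shows "v \<noteq> 0\<^sub>m d 1"
proof
  assume "v = 0\<^sub>m d 1"
  then have "dagger v * v = 0\<^sub>m 1 1" using right_mult_zero_mat[of "dagger v" 1 d 1] assms(1) by simp
  then have "tr (1\<^sub>m 1) = tr (0\<^sub>m 1 1)" using assms(2) by simp
  then show False by (simp add: tr_one tr_zero)
qed

text \<open>The Hilbert-Schmidt norm of the difference of the two sides vanishes, since Pauli strings
  are orthogonal and the expansion coefficients have modulus one.\<close>

lemma pstr_projector:
  assumes v: "v \<in> carrier_mat (2 ^ k) 1" "dagger v * v = 1\<^sub>m 1"
    and I: "finite I" "card I = 2 ^ k"
    and distinct: "\<And>x y. x \<in> I \<Longrightarrow> y \<in> I \<Longrightarrow> (\<forall>i<k. A x i = A y i) \<Longrightarrow> x = y"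
    and eig: "\<And>x. x \<in> I \<Longrightarrow> pstr k (A x) * v = e x \<cdot>\<^sub>m v"
  shows "v * dagger v =
    (1 / 2 ^ k) \<cdot>\<^sub>m msum (2 ^ k) (2 ^ k) (\<lambda>x. e x \<cdot>\<^sub>m pstr k (A x)) I"
proof -
  define d :: nat where "d = 2 ^ k"
  define X where "X = v * dagger v"
  define p where "p = (\<lambda>x. pstr k (A x))"
  define Y where "Y = (1 / 2 ^ k) \<cdot>\<^sub>m msum d d (\<lambda>x. e x \<cdot>\<^sub>m p x) I"
  note X = unit_outer_projector[OF v, folded X_def d_def]
  have p: "p x \<in> carrier_mat d d" for x by (simp add: p_def d_def)
  have Y: "Y \<in> carrier_mat d d" by (simp add: Y_def p)
  have e: "e x * e x = 1" if "x \<in> I" for x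
    using pstr_eigenvalue_square[OF v(1) unit_nonzero[OF v] eig[OF that]] .
  have dY: "dagger Y = Y"
  proof -
    have "dagger Y = (1 / 2 ^ k) \<cdot>\<^sub>m msum d d (\<lambda>x. dagger (e x \<cdot>\<^sub>m p x)) I"
      using p by (simp add: Y_def dagger_smult dagger_msum)
    also have "\<dots> = Y" unfolding Y_def
      by (intro arg_cong[where f = "(\<cdot>\<^sub>m) _"] msum_cong)
        (simp add: dagger_smult p_def pstr_dagger e cnj_sign)
    finally show ?thesis .
  qed
  \<comment> \<open>Each of the \<open>2 ^ k\<close> strings pairs with \<open>X\<close> to its
    eigenvalue, which the equal coefficient turns into one; the sum cancels the
    normalisation.\<close>
  have XY: "tr (X * Y) = 1"
  proof -
    have "e x * tr (X * p x) = 1" if "x \<in> I" for x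
    proof -
      have "p x * X = (p x * v) * dagger v"
        using p[of x] v(1) by (simp add: X_def d_def assoc_mult_mat[of _ "2 ^ k" "2 ^ k" _ 1 _ "2 ^ k"])
      also have "\<dots> = e x \<cdot>\<^sub>m X"
        using eig[OF that] v(1) by (simp add: X_def p_def mult_smult_assoc_mat[of _ "2 ^ k" 1])
      finally have "tr (X * p x) = e x"
        by (simp add: tr_mult_commute[OF X(1) p] tr_smult[OF X(1)] X(4))
      then show ?thesis using e[OF that] by simp
    qed
    then have "(\<Sum>x\<in>I. e x * tr (X * p x)) = 2 ^ k" using I by simp
    then show ?thesis using tr_mult_smult_msum[OF X(1), where p = p and I = I and c = "1 / 2 ^ k" and e = e] by (simp add: Y_def p)
  qed
  \<comment> \<open>By orthogonality and \<open>distinct\<close>, only the term of \<open>x\<close>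
    survives when \<open>p x\<close> is paired with \<open>Y\<close>.\<close>
  have YY: "tr (Y * Y) = 1"
  proof -
    have "tr (Y * p x) = e x" if "x \<in> I" for x
    proof -
      have "e y * tr (p x * p y) = (if x = y then 2 ^ k * e x else 0)" if "y \<in> I" for y
        using distinct[OF \<open>x \<in> I\<close> that] by (auto simp: p_def tr_pstr_mult)
      then have "(\<Sum>y\<in>I. e y * tr (p x * p y)) = 2 ^ k * e x"
        using I(1) that by (simp cong: sum.cong)
      then show ?thesis
        unfolding tr_mult_commute[OF Y p] using tr_mult_smult_msum[OF p[of x], where p = p and I = I and c = "1 / 2 ^ k" and e = e]
        by (simp add: Y_def p)
    qed
    then have "(\<Sum>x\<in>I. e x * tr (Y * p x)) = 2 ^ k" using I e by simp
    then show ?thesis using tr_mult_smult_msum[OF Y, where p = p and I = I and c = "1 / 2 ^ k" and e = e] by (simp add: Y_def p)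
  qed
  \<comment> \<open>The trace of the right-hand side is \<open>1 - 1 - (1 - 1)\<close>.\<close>
  have "dagger (X - Y) * (X - Y) = X * X - X * Y - (Y * X - Y * Y)"
    unfolding dagger_minus[OF X(1) Y] X(2) dY
      minus_mult_distrib_mat[OF X(1) Y minus_carrier_mat[OF Y]]
      mult_minus_distrib_mat[OF X(1) X(1) Y] mult_minus_distrib_mat[OF Y X(1) Y] ..
  moreover have "X * X \<in> carrier_mat d d" "X * Y \<in> carrier_mat d d"
    "Y * X \<in> carrier_mat d d" "Y * Y \<in> carrier_mat d d"
    using X(1) Y by (auto intro: mult_carrier_mat)
  ultimately have "tr (dagger (X - Y) * (X - Y)) = 0"
    using X(3,4) XY YY tr_mult_commute[OF X(1) Y] by (simp add: tr_minus[of _ d] minus_carrier_mat)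
  then have "X - Y = 0\<^sub>m d d"
    using tr_dagger_mult_self_eq_0[of "X - Y" d d] minus_carrier_mat[OF Y] by blast
  then have "(X - Y) $$ (i, j) = 0" if "i < d" "j < d" for i j using that by simp
  then have "X = Y" using X(1) Y by (intro eq_matI) auto
  then show ?thesis by (simp add: X_def Y_def p_def d_def)
qed

text \<open>If the string occurs up to phase in the stabilizer group, then \<open>\<psi>\<close> is
  an eigenvector. Otherwise it is orthogonal to every string in the expansion of the projector onto
  \<open>\<psi>\<close>, so its expectation value vanishes.\<close>

lemma stabilizer_state_pstr:
  assumes "stabilizer_state k \<psi>"
  shows "dagger \<psi> * (pstr k a * \<psi>) = 0\<^sub>m 1 1 \<or> (\<exists>z. pstr k a * \<psi> = z \<cdot>\<^sub>m \<psi>)"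
proof (rule disjCI)
  assume noeig: "\<not> (\<exists>z. pstr k a * \<psi> = z \<cdot>\<^sub>m \<psi>)"
  from assms obtain S where \<psi>: "\<psi> \<in> carrier_mat (2 ^ k) 1" "dagger \<psi> * \<psi> = 1\<^sub>m 1"
    and S: "S \<subseteq> pauli_group k" "finite S" "card S = 2 ^ k" and fix\<psi>: "\<And>P. P \<in> S \<Longrightarrow> P * \<psi> = \<psi>"
    by (auto simp: stabilizer_state_def is_state_def stabilizer_group_def)
  have "\<forall>P\<in>S. \<exists>c a. P = \<i> ^ c \<cdot>\<^sub>m pstr k a"
    using S(1) by (auto simp flip: pauli_group_iff)
  then obtain c A where P: "\<And>P. P \<in> S \<Longrightarrow> P = \<i> ^ c P \<cdot>\<^sub>m pstr k (A P)" by metis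
  have eig: "pstr k (A P) * \<psi> = inverse (\<i> ^ c P) \<cdot>\<^sub>m \<psi>" if "P \<in> S" for P
  proof -
    have "\<psi> = \<i> ^ c P \<cdot>\<^sub>m (pstr k (A P) * \<psi>)"
      using fix\<psi>[OF that] P[OF that] mult_smult_assoc_mat[OF pstr_carrier \<psi>(1)] by metis
    then have "inverse (\<i> ^ c P) \<cdot>\<^sub>m \<psi> = inverse (\<i> ^ c P) \<cdot>\<^sub>m (\<i> ^ c P \<cdot>\<^sub>m (pstr k (A P) * \<psi>))"
      by simp
    then show ?thesis by (simp add: mat_smult_smult mat_smult_one)
  qed
  \<comment> \<open>Two group elements with the same string have the same eigenvalue on
    \<open>\<psi>\<close>, so their phases agree. Hence the \<open>2 ^ k\<close> elements of
    \<open>S\<close> carry \<open>2 ^ k\<close> distinct strings, as \<open>pstr_projector\<close>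
    requires.\<close>
  have inj: "P = Q" if "P \<in> S" "Q \<in> S" "\<forall>i<k. A P i = A Q i" for P Q
  proof -
    have eq: "pstr k (A P) = pstr k (A Q)" using that(3) by (intro pstr_cong) simp
    then have "inverse (\<i> ^ c P) \<cdot>\<^sub>m \<psi> = inverse (\<i> ^ c Q) \<cdot>\<^sub>m \<psi>" using eig that by metis
    then have "inverse (\<i> ^ c P) = inverse (\<i> ^ c Q)" by (rule smult_cancel_nonzero[OF \<psi>(1) unit_nonzero[OF \<psi>]])
    then show ?thesis using P[OF that(1)] P[OF that(2)] eq by simp
  qed
  have "tr (pstr k a * pstr k (A P)) = 0" if "P \<in> S" for P
  proof -
    have "\<not> (\<forall>i<k. a i = A P i)" using noeig eig[OF that] pstr_cong[of k a "A P"] by metis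
    then show ?thesis by (simp add: tr_pstr_mult)
  qed
  then have "tr (pstr k a * ((1 / 2 ^ k) \<cdot>\<^sub>m
      msum (2 ^ k) (2 ^ k) (\<lambda>P. inverse (\<i> ^ c P) \<cdot>\<^sub>m pstr k (A P)) S)) = 0"
    by (subst tr_mult_smult_msum) auto
  moreover have "\<psi> * dagger \<psi> = (1 / 2 ^ k) \<cdot>\<^sub>m
      msum (2 ^ k) (2 ^ k) (\<lambda>P. inverse (\<i> ^ c P) \<cdot>\<^sub>m pstr k (A P)) S"
    by (rule pstr_projector[OF \<psi> S(2,3) inj eig])
  ultimately have "tr (pstr k a * (\<psi> * dagger \<psi>)) = 0" by (simp only:)
  moreover have "pstr k a * (\<psi> * dagger \<psi>) = (pstr k a * \<psi>) * dagger \<psi>"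
    using \<psi>(1) by (simp add: assoc_mult_mat[of _ "2 ^ k" "2 ^ k" _ 1 _ "2 ^ k"])
  moreover have car: "pstr k a * \<psi> \<in> carrier_mat (2 ^ k) 1" "dagger \<psi> \<in> carrier_mat 1 (2 ^ k)"
    using \<psi>(1) mult_carrier_mat[OF pstr_carrier] by auto
  ultimately have "tr (dagger \<psi> * (pstr k a * \<psi>)) = 0"
    using tr_mult_commute[OF car] by simp
  then show "dagger \<psi> * (pstr k a * \<psi>) = 0\<^sub>m 1 1"
    using tr_one_dim[OF mult_carrier_mat[OF car(2,1)]] by auto
qed

text \<open>The string splits into a data part and an ancilla part, and \<open>W\<close> contracts
  only the latter with \<open>\<psi>\<close>. By \<open>stabilizer_state_pstr\<close>, either the
  ancilla part has expectation zero and the compression dies, or it has \<open>\<psi>\<close> as an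
  eigenvector and comes out as a sign.\<close>

lemma bra_pstr:
  fixes n m :: nat
  assumes "stabilizer_state m \<psi>"
  defines "W \<equiv> kron (1\<^sub>m (2 ^ n)) (dagger \<psi>)"
  shows "W * pstr (n + m) a * dagger W = 0\<^sub>m (2 ^ n) (2 ^ n) \<or>
    (\<exists>z. z * z = 1 \<and> W * pstr (n + m) a = z \<cdot>\<^sub>m (pstr n a * W))"
proof -
  define b where "b = (\<lambda>i. a (n + i))"
  have \<psi>: "\<psi> \<in> carrier_mat (2 ^ m) 1" "dagger \<psi> * \<psi> = 1\<^sub>m 1"
    using assms(1) by (auto simp: stabilizer_state_def is_state_def)
  have d\<psi>: "dagger \<psi> \<in> carrier_mat 1 (2 ^ m)" using \<psi>(1) by simp
  have Wq: "W * pstr (n + m) a = kron (pstr n a) (dagger \<psi> * pstr m b)"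
    unfolding W_def pstr_add b_def[symmetric]
    by (subst kron_mult[OF one_carrier_mat pstr_carrier d\<psi> pstr_carrier]) simp
  have dW: "dagger W = kron (1\<^sub>m (2 ^ n)) \<psi>" by (simp add: W_def dagger_kron)
  from stabilizer_state_pstr[OF assms(1), of b] show ?thesis
  proof
    assume 0: "dagger \<psi> * (pstr m b * \<psi>) = 0\<^sub>m 1 1"
    have "W * pstr (n + m) a * dagger W = kron (pstr n a * 1\<^sub>m (2 ^ n)) (dagger \<psi> * pstr m b * \<psi>)"
      unfolding Wq dW
      by (rule kron_mult[OF pstr_carrier one_carrier_mat mult_carrier_mat[OF d\<psi> pstr_carrier] \<psi>(1)])
    also have "dagger \<psi> * pstr m b * \<psi> = 0\<^sub>m 1 1"
      using 0 assoc_mult_mat[OF d\<psi> pstr_carrier \<psi>(1)] by simp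
    finally show ?thesis by (simp add: kron_zero_right)
  next
    assume "\<exists>z. pstr m b * \<psi> = z \<cdot>\<^sub>m \<psi>"
    then obtain z where z: "pstr m b * \<psi> = z \<cdot>\<^sub>m \<psi>" ..
    have zz: "z * z = 1" using pstr_eigenvalue_square[OF \<psi>(1) unit_nonzero[OF \<psi>] z] .
    \<comment> \<open>The adjoint of the eigenvalue equation: the string is Hermitian and the sign
      \<open>z\<close> is real.\<close>
    have "dagger \<psi> * pstr m b = z \<cdot>\<^sub>m dagger \<psi>"
      using dagger_mult[OF pstr_carrier \<psi>(1), of b] zz by (simp add: z pstr_dagger dagger_smult cnj_sign)
    then have "W * pstr (n + m) a = z \<cdot>\<^sub>m kron (pstr n a) (dagger \<psi>)"
      unfolding Wq by (simp add: kron_smult_right)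
    also have "kron (pstr n a) (dagger \<psi>) = pstr n a * W"
    proof -
      have "kron (pstr n a) (1\<^sub>m 1) * W = kron (pstr n a * 1\<^sub>m (2 ^ n)) (1\<^sub>m 1 * dagger \<psi>)"
        unfolding W_def by (rule kron_mult[OF pstr_carrier one_carrier_mat one_carrier_mat d\<psi>])
      then show ?thesis using \<psi>(1) by (simp add: kron_one_right del: One_nat_def)
    qed
    finally show ?thesis using zz by blast
  qed
qed

text \<open>\<open>W\<close> is a coisometry because \<open>\<psi>\<close> is a unit vector. This
  carries completeness of the basis over to the compressed vectors and removes \<open>W\<close> from
  the compressed strings.\<close>

lemma bra_isometry:
  fixes n m :: nat
  assumes "is_state m \<psi>"
  defines "W \<equiv> kron (1\<^sub>m (2 ^ n)) (dagger \<psi>)"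
  shows "W \<in> carrier_mat (2 ^ n) (2 ^ (n + m))" "W * dagger W = 1\<^sub>m (2 ^ n)"
proof -
  have \<psi>: "\<psi> \<in> carrier_mat (2 ^ m) 1" "dagger \<psi> * \<psi> = 1\<^sub>m 1"
    using assms(1) by (auto simp: is_state_def)
  have d\<psi>: "dagger \<psi> \<in> carrier_mat 1 (2 ^ m)" using \<psi>(1) by simp
  show "W \<in> carrier_mat (2 ^ n) (2 ^ (n + m))"
    using kron_carrier[OF one_carrier_mat d\<psi>, of "2 ^ n"] by (simp add: W_def power_add)
  show "W * dagger W = 1\<^sub>m (2 ^ n)"
    unfolding W_def dagger_kron dagger_dagger dagger_one
      kron_mult[OF one_carrier_mat one_carrier_mat d\<psi> \<psi>(1)] \<psi>(2)
    by (simp add: kron_one_right del: One_nat_def)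
qed

text \<open>Multiplying strings adds their labels up to a power of \<open>\<i>\<close>, so products
  of generators become subset sums of labels. The induction runs over lists without repetitions,
  since \<open>prod_gens\<close> is a fold over a sorted list.\<close>

lemma prod_gens_pstr:
  assumes g: "\<And>j. j < k \<Longrightarrow> g j = \<i> ^ c j \<cdot>\<^sub>m pstr k (a j)" and J: "J \<subseteq> {..<k}"
  shows "\<exists>t::nat. prod_gens k g J = \<i> ^ t \<cdot>\<^sub>m pstr k (\<Sum>j\<in>J. a j)"
proof -
  have "set xs \<subseteq> {..<k} \<Longrightarrow> distinct xs \<Longrightarrow>
      \<exists>t::nat. foldr (\<lambda>j M. g j * M) xs (1\<^sub>m (2 ^ k)) = \<i> ^ t \<cdot>\<^sub>m pstr k (\<Sum>j\<in>set xs. a j)" for xs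
  proof (induction xs)
    case Nil
    have "1\<^sub>m (2 ^ k) = \<i> ^ 0 \<cdot>\<^sub>m pstr k 0" by (simp add: zero_fun_def pstr_zero mat_smult_one)
    then show ?case unfolding list.set sum.empty foldr.simps id_apply by blast
  next
    case (Cons j xs)
    then obtain t where t: "foldr (\<lambda>j M. g j * M) xs (1\<^sub>m (2 ^ k)) = \<i> ^ t \<cdot>\<^sub>m pstr k (\<Sum>j\<in>set xs. a j)"
      by auto
    obtain u where u: "pstr k (a j) * pstr k (\<Sum>j\<in>set xs. a j) = \<i> ^ u \<cdot>\<^sub>m pstr k (a j + (\<Sum>j\<in>set xs. a j))"
      using pstr_mult unfolding plus_fun_def by blast
    have "foldr (\<lambda>j M. g j * M) (j # xs) (1\<^sub>m (2 ^ k)) =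
        \<i> ^ (c j + t + u) \<cdot>\<^sub>m pstr k (a j + (\<Sum>j\<in>set xs. a j))"
      using Cons.prems
      by (simp add: t g mult_smult_assoc_mat[OF pstr_carrier smult_carrier_mat[OF pstr_carrier]]
          mult_smult_distrib[OF pstr_carrier pstr_carrier] u mat_smult_smult power_add mult.assoc)
    moreover have "(\<Sum>i\<in>set (j # xs). a i) = a j + (\<Sum>j\<in>set xs. a j)"
      using Cons.prems(2) by simp
    ultimately show ?case by metis
  qed
  from this[of "sorted_list_of_set J"] show ?thesis
    using J finite_subset[OF J] by (simp add: prod_gens_def)
qed

section \<open>Independent generators\<close>

lemma sum_fun_apply: "(\<Sum>x\<in>A. f x) i = (\<Sum>x\<in>A. f x i)"
  for f :: "'a \<Rightarrow> 'b \<Rightarrow> 'c::comm_monoid_add"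
  by (induction A rule: infinite_finite_induct) auto

text \<open>Elements of the intersection occur twice on the right and cancel.\<close>

lemma sum_sym_diff:
  fixes a :: "'a \<Rightarrow> 'b::comm_monoid_add"
  assumes "finite A" "finite B" and double: "\<And>x::'b. x + x = 0"
  shows "sum a (sym_diff A B) = sum a A + sum a B"
proof -
  have "sum a A = sum a (A - B) + sum a (A \<inter> B)"
    using sum.Int_Diff[OF assms(1), of a B] by (simp add: add.commute)
  moreover have "sum a B = sum a (B - A) + sum a (A \<inter> B)"
    using sum.Int_Diff[OF assms(2), of a A] by (simp add: add.commute Int_commute)
  ultimately have "sum a A + sum a B = sum a (A - B) + sum a (B - A) + (sum a (A \<inter> B) + sum a (A \<inter> B))"
    by (simp add: ac_simps)
  also have "\<dots> = sum a (sym_diff A B)"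
    using assms(1,2) by (subst sum.union_disjoint) (auto simp: double)
  finally show ?thesis ..
qed

text \<open>Greedy choice over the two-element field: \<open>k < n\<close> chosen elements have at
  most \<open>2 ^ k\<close> subset sums, fewer than \<open>D\<close> has elements, so some element
  of \<open>D\<close> lies outside their span.\<close>

lemma exists_independent_family:
  fixes D :: "'b::comm_monoid_add set"
  assumes "finite D" "2 ^ n \<le> card D" and double: "\<And>x::'b. x + x = 0"
  shows "\<exists>a::nat \<Rightarrow> 'b. (\<forall>j<n. a j \<in> D) \<and> (\<forall>J\<subseteq>{..<n}. sum a J = 0 \<longrightarrow> J = {})"
proof -
  have "k \<le> n \<Longrightarrow> \<exists>a::nat \<Rightarrow> 'b. (\<forall>j<k. a j \<in> D) \<and> (\<forall>J\<subseteq>{..<k}. sum a J = 0 \<longrightarrow> J = {})" for k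
  proof (induction k)
    case (Suc k)
    then obtain a :: "nat \<Rightarrow> 'b" where a: "\<And>j. j < k \<Longrightarrow> a j \<in> D"
      "\<And>J. J \<subseteq> {..<k} \<Longrightarrow> sum a J = 0 \<Longrightarrow> J = {}"
      by auto
    have "card (sum a ` Pow {..<k}) \<le> 2 ^ k"
      using card_image_le[of "Pow {..<k}" "sum a"] by (simp add: card_Pow)
    also have "\<dots> < 2 ^ n" using Suc.prems by simp
    finally have "\<not> D \<subseteq> sum a ` Pow {..<k}"
      using assms(2) card_mono[of "sum a ` Pow {..<k}" D] by auto
    then obtain x where x: "x \<in> D" "x \<notin> sum a ` Pow {..<k}" by blast
    define a' where "a' = a(k := x)"
    have "J = {}" if J: "J \<subseteq> {..<Suc k}" "sum a' J = 0" for J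
    proof (cases "k \<in> J")
      case False
      then have "J \<subseteq> {..<k}" using J(1) less_Suc_eq by auto
      moreover have "sum a' J = sum a J" using False by (intro sum.cong) (auto simp: a'_def)
      ultimately show ?thesis using J(2) a(2) by simp
    next
      case True
      have fin: "finite J" using J(1) finite_subset by blast
      have "sum a' (J - {k}) = sum a (J - {k})" by (intro sum.cong) (auto simp: a'_def)
      then have "x + sum a (J - {k}) = 0" using J(2) True fin by (simp add: sum.remove a'_def)
      \<comment> \<open>Adding the remaining sum to both sides isolates \<open>x\<close> and puts it
        among the excluded subset sums.\<close>
      then have "x + (sum a (J - {k}) + sum a (J - {k})) = sum a (J - {k})"
        by (metis add.assoc add_0)
      then have "x = sum a (J - {k})" using double by simp
      moreover have "J - {k} \<subseteq> {..<k}" using J(1) less_Suc_eq by auto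
      ultimately show ?thesis using x(2) by blast
    qed
    moreover have "\<forall>j<Suc k. a' j \<in> D" using a(1) x(1) by (simp add: a'_def less_Suc_eq)
    ultimately show ?case by blast
  qed simp
  then show ?thesis by blast
qed

lemma pauli1_fun_double: "a + a = (0 :: nat \<Rightarrow> pauli1)"
  by (rule ext) (simp add: pauli1_double)

text \<open>Up to phase, a product of generators is the string of the summed label, which is a
  scalar exactly when the label vanishes below \<open>k\<close>. Independence of operators thus
  becomes linear independence of labels over the two-element field.\<close>

lemma independent_paulis_pstr:
  assumes g: "\<And>j. j < k \<Longrightarrow> g j = \<i> ^ c j \<cdot>\<^sub>m pstr k (a j)"
  shows "independent_paulis k g \<longleftrightarrow>
    (\<forall>J\<subseteq>{..<k}. (\<forall>i<k. (\<Sum>j\<in>J. a j) i = 0) \<longrightarrow> J = {})"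
proof -
  have "(\<exists>z. prod_gens k g J = z \<cdot>\<^sub>m 1\<^sub>m (2 ^ k)) \<longleftrightarrow> (\<forall>i<k. (\<Sum>j\<in>J. a j) i = 0)"
    if J: "J \<subseteq> {..<k}" for J
  proof -
    obtain t where t: "prod_gens k g J = \<i> ^ t \<cdot>\<^sub>m pstr k (\<Sum>j\<in>J. a j)"
      using prod_gens_pstr[of k g c a J, OF g J] by blast
    show ?thesis
    proof (intro iffI allI impI)
      fix i assume "\<exists>z. prod_gens k g J = z \<cdot>\<^sub>m 1\<^sub>m (2 ^ k)" and i: "i < k"
      then obtain z where z: "\<i> ^ t \<cdot>\<^sub>m pstr k (\<Sum>j\<in>J. a j) = z \<cdot>\<^sub>m pstr k (\<lambda>_. 0)"
        using t by (auto simp: pstr_zero)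
      have "pstr k (\<Sum>j\<in>J. a j) = inverse (\<i> ^ t) \<cdot>\<^sub>m (\<i> ^ t \<cdot>\<^sub>m pstr k (\<Sum>j\<in>J. a j))"
        by (simp add: mat_smult_smult mat_smult_one)
      also have "\<dots> = (inverse (\<i> ^ t) * z) \<cdot>\<^sub>m pstr k (\<lambda>_. 0)"
        unfolding z mat_smult_smult ..
      finally show "(\<Sum>j\<in>J. a j) i = 0" by (rule pstr_eq_smultD) (rule i)
    next
      assume "\<forall>i<k. (\<Sum>j\<in>J. a j) i = 0"
      then have "pstr k (\<Sum>j\<in>J. a j) = 1\<^sub>m (2 ^ k)"
        using pstr_cong[of k "\<Sum>j\<in>J. a j" "\<lambda>_. 0"] by (simp add: pstr_zero)
      then show "\<exists>z. prod_gens k g J = z \<cdot>\<^sub>m 1\<^sub>m (2 ^ k)" using t by metis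
    qed
  qed
  then show ?thesis unfolding independent_paulis_def by (simp only: cong: imp_cong)
qed

text \<open>The string of a sum is the product of the strings up to an invertible phase, so a joint
  eigenvector of the factors remains an eigenvector.\<close>

lemma pstr_sum_eigenvector:
  assumes v: "v \<in> carrier_mat (2 ^ k) 1" and J: "finite J"
    and eig: "\<And>j. j \<in> J \<Longrightarrow> \<exists>z. pstr k (a j) * v = z \<cdot>\<^sub>m v"
  shows "\<exists>z. pstr k (\<Sum>j\<in>J. a j) * v = z \<cdot>\<^sub>m v"
  using J eig
proof (induction J rule: finite_induct)
  case empty
  have "pstr k 0 * v = 1 \<cdot>\<^sub>m v" using v by (simp add: zero_fun_def pstr_zero mat_smult_one)
  then show ?case unfolding sum.empty by blast
next
  case (insert j J)
  let ?s = "\<Sum>j\<in>J. a j"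
  obtain z w where z: "pstr k (a j) * v = z \<cdot>\<^sub>m v" and w: "pstr k ?s * v = w \<cdot>\<^sub>m v"
    using insert by blast
  obtain t where t: "pstr k (a j) * pstr k ?s = \<i> ^ t \<cdot>\<^sub>m pstr k (a j + ?s)"
    using pstr_mult unfolding plus_fun_def by blast
  have "pstr k (a j + ?s) * v = inverse (\<i> ^ t) \<cdot>\<^sub>m (\<i> ^ t \<cdot>\<^sub>m (pstr k (a j + ?s) * v))"
    by (simp only: mat_smult_smult) (simp add: mat_smult_one)
  also have "\<i> ^ t \<cdot>\<^sub>m (pstr k (a j + ?s) * v) = pstr k (a j) * pstr k ?s * v"
    unfolding t by (rule mult_smult_assoc_mat[OF pstr_carrier v, symmetric])
  also have "\<dots> = (w * z) \<cdot>\<^sub>m v"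
    using assoc_mult_mat[OF pstr_carrier pstr_carrier v]
    by (simp add: w mult_smult_distrib[OF pstr_carrier v] z mat_smult_smult)
  finally show ?case using insert(1,2) by (metis mat_smult_smult sum.insert)
qed

section \<open>Stabilizer bases: distinct strings and completeness\<close>

lemma stabilizer_basis_pstr:
  assumes "stabilizer_basis k \<Phi>"
  obtains A where
    "\<And>J J'. J \<subseteq> {..<k} \<Longrightarrow> J' \<subseteq> {..<k} \<Longrightarrow> (\<forall>i<k. A J i = A J' i) \<Longrightarrow> J = J'"
    "\<And>J b. J \<subseteq> {..<k} \<Longrightarrow> b < 2 ^ k \<Longrightarrow> \<exists>e. pstr k (A J) * \<Phi> b = e \<cdot>\<^sub>m \<Phi> b"
proof -
  from assms obtain g where car: "\<And>b. b < 2 ^ k \<Longrightarrow> \<Phi> b \<in> carrier_mat (2 ^ k) 1"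
    and gp: "\<And>j. j < k \<Longrightarrow> g j \<in> pauli_group k" and ind: "independent_paulis k g"
    and eig: "\<And>b j. b < 2 ^ k \<Longrightarrow> j < k \<Longrightarrow> \<exists>e. g j * \<Phi> b = e \<cdot>\<^sub>m \<Phi> b"
    unfolding stabilizer_basis_def by blast
  from gp obtain c a where g: "\<And>j. j < k \<Longrightarrow> g j = \<i> ^ c j \<cdot>\<^sub>m pstr k (a j)"
    unfolding pauli_group_iff by metis
  have eig': "\<exists>e. pstr k (a j) * \<Phi> b = e \<cdot>\<^sub>m \<Phi> b" if b: "b < 2 ^ k" and j: "j < k" for b j
  proof -
    obtain e where e: "g j * \<Phi> b = e \<cdot>\<^sub>m \<Phi> b" using eig[OF b j] by blast
    have "pstr k (a j) * \<Phi> b = inverse (\<i> ^ c j) \<cdot>\<^sub>m (\<i> ^ c j \<cdot>\<^sub>m (pstr k (a j) * \<Phi> b))"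
      by (simp only: mat_smult_smult) (simp add: mat_smult_one)
    also have "\<i> ^ c j \<cdot>\<^sub>m (pstr k (a j) * \<Phi> b) = e \<cdot>\<^sub>m \<Phi> b"
      using e unfolding g[OF j] mult_smult_assoc_mat[OF pstr_carrier car[OF b]] .
    finally show ?thesis unfolding mat_smult_smult by blast
  qed
  show thesis
  \<comment> \<open>The subsets \<open>J\<close> index the \<open>2 ^ k\<close> products of
    generators, and this sum is the label of the product over \<open>J\<close>.\<close>
  proof (rule that[of "\<lambda>J. \<Sum>j\<in>J. a j"])
    fix J J' :: "nat set"
    assume J: "J \<subseteq> {..<k}" "J' \<subseteq> {..<k}" "\<forall>i<k. (\<Sum>j\<in>J. a j) i = (\<Sum>j\<in>J'. a j) i"
    then have fin: "finite J" "finite J'" using finite_subset by blast+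
    \<comment> \<open>Equal sums cancel, so the product over the symmetric difference is a scalar
      and independence makes that set empty.\<close>
    have "(\<Sum>j\<in>sym_diff J J'. a j) i = 0" if "i < k" for i
    proof -
      have "(\<Sum>j\<in>sym_diff J J'. a j) i = (\<Sum>j\<in>J. a j) i + (\<Sum>j\<in>J'. a j) i"
        unfolding sum_sym_diff[of J J' a, OF fin pauli1_fun_double] by (rule plus_fun_apply)
      then show ?thesis using J(3) that by (simp add: pauli1_double)
    qed
    then have zero: "\<forall>i<k. (\<Sum>j\<in>sym_diff J J'. a j) i = 0" by blast
    have indep: "\<forall>J\<subseteq>{..<k}. (\<forall>i<k. (\<Sum>j\<in>J. a j) i = 0) \<longrightarrow> J = {}"
      using ind independent_paulis_pstr[of k g c a, OF g] by simp
    have sub: "sym_diff J J' \<subseteq> {..<k}" using J(1,2) by blast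
    have "sym_diff J J' = {}" by (rule mp[OF mp[OF spec[OF indep] sub] zero])
    then show "J = J'" by blast
  next
    fix J b assume "J \<subseteq> {..<k}" "b < (2::nat) ^ k"
    then show "\<exists>e. pstr k (\<Sum>j\<in>J. a j) * \<Phi> b = e \<cdot>\<^sub>m \<Phi> b"
      by (intro pstr_sum_eigenvector car eig') (auto intro: finite_subset)
  qed
qed

text \<open>The matrix with columns \<open>\<Phi> b\<close> has orthonormal columns; being square,
  it is unitary, and the reverse product is the sum of the projectors.\<close>

lemma orthonormal_basis_complete:
  assumes car: "\<And>b. b < d \<Longrightarrow> \<Phi> b \<in> carrier_mat d 1"
    and orth: "\<And>b c. b < d \<Longrightarrow> c < d \<Longrightarrow>
      dagger (\<Phi> b) * \<Phi> c = (if b = c then 1\<^sub>m 1 else 0\<^sub>m 1 1)"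
  shows "msum d d (\<lambda>b. \<Phi> b * dagger (\<Phi> b)) {..<d} = 1\<^sub>m d"
proof -
  define U where "U = mat d d (\<lambda>(i, b). \<Phi> b $$ (i, 0))"
  have U: "U \<in> carrier_mat d d" "dagger U \<in> carrier_mat d d" by (simp_all add: U_def)
  have "dagger U * U = 1\<^sub>m d"
  proof (rule eq_matI)
    fix b c assume "b < dim_row (1\<^sub>m d :: complex mat)" "c < dim_col (1\<^sub>m d :: complex mat)"
    then have bc: "b < d" "c < d" by simp_all
    have dcar: "dagger (\<Phi> b) \<in> carrier_mat 1 d" using car[OF bc(1)] by simp
    have 01: "0 < (1::nat)" by simp
    have "(dagger U * U) $$ (b, c) = (dagger (\<Phi> b) * \<Phi> c) $$ (0, 0)"
      unfolding index_mult_sum[OF U(2,1) bc]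
        index_mult_sum[OF dcar car[OF bc(2)] 01 01]
      using bc car[OF bc(1)] by (intro sum.cong) (auto simp: U_def)
    then show "(dagger U * U) $$ (b, c) = 1\<^sub>m d $$ (b, c)" using bc orth by simp
  qed (simp_all add: U_def)
  then have UU: "U * dagger U = 1\<^sub>m d" by (rule mat_mult_left_right_inverse[OF U(2,1)])
  show ?thesis
  proof (rule eq_matI)
    fix i j assume "i < dim_row (1\<^sub>m d :: complex mat)" "j < dim_col (1\<^sub>m d :: complex mat)"
    then have ij: "i < d" "j < d" by simp_all
    have "(\<Phi> b * dagger (\<Phi> b)) $$ (i, j) = U $$ (i, b) * dagger U $$ (b, j)" if "b < d" for b
    proof -
      have dcar: "dagger (\<Phi> b) \<in> carrier_mat 1 d" using car[OF that] by simp
      show ?thesis unfolding index_mult_sum[OF car[OF that] dcar ij]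
        using ij that car[OF that] by (auto simp: U_def)
    qed
    then have "msum d d (\<lambda>b. \<Phi> b * dagger (\<Phi> b)) {..<d} $$ (i, j) = (U * dagger U) $$ (i, j)"
      unfolding index_mult_sum[OF U ij] using ij by (simp add: msum_def del: index_mult_mat)
    then show "msum d d (\<lambda>b. \<Phi> b * dagger (\<Phi> b)) {..<d} $$ (i, j) = 1\<^sub>m d $$ (i, j)"
      using UU by simp
  qed (simp_all add: msum_def)
qed

section \<open>Compressed projectors expanded in Pauli strings\<close>

text \<open>The properties of the compressed vectors on which the counting rests. \<open>K\<close>
  indexes the surviving strings and \<open>P J\<close> is the label on the data qubits; different
  indices may give the same string. One family \<open>\<epsilon>\<close> serves both as eigenvalues
  and as expansion coefficients.\<close>

locale pauli_frame =
  fixes n m :: nat and \<phi> :: "nat \<Rightarrow> complex mat" and K :: "'a set"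
    and P :: "'a \<Rightarrow> nat \<Rightarrow> pauli1" and \<epsilon> :: "nat \<Rightarrow> 'a \<Rightarrow> complex"
  assumes carrier: "\<And>b. b < 2 ^ (n + m) \<Longrightarrow> \<phi> b \<in> carrier_mat (2 ^ n) 1"
    and finite_K: "finite K"
    and eigenvector: "\<And>b J. b < 2 ^ (n + m) \<Longrightarrow> J \<in> K \<Longrightarrow> pstr n (P J) * \<phi> b = \<epsilon> b J \<cdot>\<^sub>m \<phi> b"
    and expansion: "\<And>b. b < 2 ^ (n + m) \<Longrightarrow> \<phi> b * dagger (\<phi> b) =
      (1 / 2 ^ (n + m)) \<cdot>\<^sub>m msum (2 ^ n) (2 ^ n) (\<lambda>J. \<epsilon> b J \<cdot>\<^sub>m pstr n (P J)) K"
    and complete: "msum (2 ^ n) (2 ^ n) (\<lambda>b. \<phi> b * dagger (\<phi> b)) {..<2 ^ (n + m)} = 1\<^sub>m (2 ^ n)"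
begin

definition \<rho> :: "nat \<Rightarrow> complex mat" where "\<rho> b = \<phi> b * dagger (\<phi> b)"

definition B :: "nat set" where "B = {b. b < 2 ^ (n + m) \<and> \<phi> b \<noteq> 0\<^sub>m (2 ^ n) 1}"

text \<open>The surviving strings that act trivially on the data qubits. Their number determines the
  common trace of the nonzero \<open>\<rho> b\<close> and turns out to be
  \<open>2 ^ l\<close>.\<close>

definition T :: "'a set" where "T = {J \<in> K. \<forall>i<n. P J i = 0}"

lemma B_less: "b \<in> B \<Longrightarrow> b < 2 ^ (n + m)"
  by (simp add: B_def)

lemma B_nonzero: "b \<in> B \<Longrightarrow> \<phi> b \<noteq> 0\<^sub>m (2 ^ n) 1"
  by (simp add: B_def)

lemma finite_B: "finite B"
  by (simp add: B_def)

lemma dagger_carrier_phi: "b < 2 ^ (n + m) \<Longrightarrow> dagger (\<phi> b) \<in> carrier_mat 1 (2 ^ n)"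
  using carrier by simp

lemma \<rho>_carrier: "b < 2 ^ (n + m) \<Longrightarrow> \<rho> b \<in> carrier_mat (2 ^ n) (2 ^ n)"
  unfolding \<rho>_def by (rule mult_carrier_mat[OF carrier dagger_carrier_phi])

lemma tr_\<rho>: "b < 2 ^ (n + m) \<Longrightarrow> tr (\<rho> b) = tr (dagger (\<phi> b) * \<phi> b)"
  unfolding \<rho>_def by (rule tr_mult_commute[OF carrier dagger_carrier_phi])

lemma tr_\<rho>_nonzero: "b \<in> B \<Longrightarrow> tr (\<rho> b) \<noteq> 0"
  using tr_dagger_mult_self_eq_0[OF carrier[OF B_less]] B_nonzero tr_\<rho>[OF B_less] by metis

lemma \<rho>_zero: "b < 2 ^ (n + m) \<Longrightarrow> b \<notin> B \<Longrightarrow> \<rho> b = 0\<^sub>m (2 ^ n) (2 ^ n)"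
  using dagger_carrier_phi[of b] left_mult_zero_mat[of "dagger (\<phi> b)" 1 "2 ^ n" "2 ^ n"]
  by (simp add: B_def \<rho>_def)

lemma \<rho>_nonzero: "b \<in> B \<Longrightarrow> \<rho> b \<noteq> 0\<^sub>m (2 ^ n) (2 ^ n)"
  using tr_\<rho>_nonzero tr_zero by metis

lemma eigenvalue_square: "b \<in> B \<Longrightarrow> J \<in> K \<Longrightarrow> \<epsilon> b J * \<epsilon> b J = 1"
  by (rule pstr_eigenvalue_square[OF carrier B_nonzero eigenvector]) (simp_all add: B_less)

lemma eigenvalue_cong:
  assumes "b \<in> B" "J \<in> K" "J' \<in> K" "\<forall>i<n. P J i = P J' i"
  shows "\<epsilon> b J = \<epsilon> b J'"
proof -
  have "pstr n (P J) = pstr n (P J')" using assms(4) by (intro pstr_cong) simp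
  then have "\<epsilon> b J \<cdot>\<^sub>m \<phi> b = \<epsilon> b J' \<cdot>\<^sub>m \<phi> b"
    using eigenvector[OF B_less[OF assms(1)] assms(2)] eigenvector[OF B_less[OF assms(1)] assms(3)]
    by simp
  then show ?thesis by (rule smult_cancel_nonzero[OF carrier[OF B_less[OF assms(1)]] B_nonzero[OF assms(1)]])
qed

lemma tr_pstr_mult_\<rho>_eigenvalue:
  assumes "b < 2 ^ (n + m)" "J \<in> K"
  shows "tr (pstr n (P J) * \<rho> b) = \<epsilon> b J * tr (\<rho> b)"
proof -
  have "pstr n (P J) * \<rho> b = (pstr n (P J) * \<phi> b) * dagger (\<phi> b)"
    unfolding \<rho>_def by (rule assoc_mult_mat[OF pstr_carrier carrier dagger_carrier_phi, symmetric]) fact+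
  also have "\<dots> = \<epsilon> b J \<cdot>\<^sub>m \<rho> b"
    unfolding eigenvector[OF assms] \<rho>_def
    by (rule mult_smult_assoc_mat[OF carrier dagger_carrier_phi]) fact+
  finally show ?thesis using tr_smult[OF \<rho>_carrier[OF assms(1)]] by simp
qed

text \<open>By orthogonality, the pairing collects the coefficients of all indices with the same
  string. Comparison with \<open>tr_pstr_mult_\<rho>_eigenvalue\<close> later yields the
  multiplicity of each string.\<close>

lemma tr_pstr_mult_\<rho>_expansion:
  assumes "b < 2 ^ (n + m)"
  shows "tr (pstr n a * \<rho> b) = (\<Sum>J\<in>{J \<in> K. \<forall>i<n. P J i = a i}. \<epsilon> b J) / 2 ^ m"
proof -
  have "tr (pstr n a * \<rho> b) = (1 / 2 ^ (n + m)) * (\<Sum>J\<in>K. \<epsilon> b J * tr (pstr n a * pstr n (P J)))"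
    unfolding \<rho>_def expansion[OF assms] by (rule tr_mult_smult_msum) simp_all
  also have "(\<Sum>J\<in>K. \<epsilon> b J * tr (pstr n a * pstr n (P J))) =
      (\<Sum>J\<in>K. if \<forall>i<n. P J i = a i then 2 ^ n * \<epsilon> b J else 0)"
    by (rule sum.cong) (auto simp: tr_pstr_mult)
  also have "\<dots> = (\<Sum>J\<in>{J \<in> K. \<forall>i<n. P J i = a i}. 2 ^ n * \<epsilon> b J)"
    using finite_K by (subst sum.inter_filter[symmetric]) auto
  finally show ?thesis by (simp add: power_add sum_distrib_left[symmetric])
qed

text \<open>Pairing with the identity string collects the coefficients over \<open>T\<close>. Each
  of them is one, because the identity fixes the nonzero vector \<open>\<phi> b\<close>.\<close>

lemma tr_\<rho>_eq:
  assumes b: "b \<in> B"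
  shows "tr (\<rho> b) = of_nat (card T) / 2 ^ m"
proof -
  have "\<epsilon> b J = 1" if J: "J \<in> T" for J
  proof -
    have "pstr n (P J) = 1\<^sub>m (2 ^ n)"
      using J pstr_cong[of n "P J" "\<lambda>_. 0"] by (simp add: T_def pstr_zero)
    then have "1 \<cdot>\<^sub>m \<phi> b = \<epsilon> b J \<cdot>\<^sub>m \<phi> b"
      using eigenvector[OF B_less[OF b], of J] J carrier[OF B_less[OF b]] by (simp add: T_def mat_smult_one)
    from smult_cancel_nonzero[OF carrier[OF B_less[OF b]] B_nonzero[OF b] this] show ?thesis by simp
  qed
  then have "(\<Sum>J\<in>{J \<in> K. \<forall>i<n. P J i = 0}. \<epsilon> b J) = of_nat (card T)" by (simp add: T_def)
  then show ?thesis
    using tr_pstr_mult_\<rho>_expansion[OF B_less[OF b], of "\<lambda>_. 0"] \<rho>_carrier[OF B_less[OF b]]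
    by (simp add: pstr_zero)
qed

section \<open>Overlaps of the compressed vectors\<close>

lemma \<rho>_mult:
  assumes "b < 2 ^ (n + m)" "b' < 2 ^ (n + m)"
  shows "\<rho> b * \<phi> b' = tr (dagger (\<phi> b) * \<phi> b') \<cdot>\<^sub>m \<phi> b"
proof -
  have "\<rho> b * \<phi> b' = \<phi> b * (dagger (\<phi> b) * \<phi> b')"
    unfolding \<rho>_def by (rule assoc_mult_mat[OF carrier dagger_carrier_phi carrier]) fact+
  also have "dagger (\<phi> b) * \<phi> b' = tr (dagger (\<phi> b) * \<phi> b') \<cdot>\<^sub>m 1\<^sub>m 1"
    by (rule tr_one_dim[OF mult_carrier_mat[OF dagger_carrier_phi carrier]]) fact+
  finally show ?thesis
    using carrier[OF assms(1)] mult_smult_distrib[OF carrier[OF assms(1)] one_carrier_mat] by simp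
qed

text \<open>\<open>\<rho> b\<close> maps \<open>\<phi> b'\<close> into the line of
  \<open>\<phi> b\<close>, while its Pauli expansion makes \<open>\<phi> b'\<close> an eigenvector.
  If the overlap is nonzero, the vectors are parallel, and equal norms then make the two operators
  equal.\<close>

lemma parallel_or_orthogonal:
  assumes b: "b \<in> B" and b': "b' \<in> B"
  shows "\<rho> b = \<rho> b' \<or> dagger (\<phi> b) * \<phi> b' = 0\<^sub>m 1 1"
proof (rule disjCI)
  assume nonorth: "dagger (\<phi> b) * \<phi> b' \<noteq> 0\<^sub>m 1 1"
  note lt = B_less[OF b] B_less[OF b']
  define t where "t = tr (dagger (\<phi> b) * \<phi> b')"
  have "t \<noteq> 0"
    using nonorth tr_one_dim[OF mult_carrier_mat[OF dagger_carrier_phi[OF lt(1)] carrier[OF lt(2)]]]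
    unfolding t_def by auto
  \<comment> \<open>The eigenvalue of \<open>\<rho> b\<close> at \<open>\<phi> b'\<close>, read off
    from the Pauli expansion.\<close>
  define z where "z = (1 / 2 ^ (n + m)) * (\<Sum>J\<in>K. \<epsilon> b J * \<epsilon> b' J)"
  have "msum (2 ^ n) (2 ^ n) (\<lambda>J. \<epsilon> b J \<cdot>\<^sub>m pstr n (P J)) K * \<phi> b' =
      msum (2 ^ n) 1 (\<lambda>J. (\<epsilon> b J \<cdot>\<^sub>m pstr n (P J)) * \<phi> b') K"
    by (rule msum_mult[OF _ carrier]) (simp_all add: lt)
  also have "\<dots> = msum (2 ^ n) 1 (\<lambda>J. (\<epsilon> b J * \<epsilon> b' J) \<cdot>\<^sub>m \<phi> b') K"
    by (rule msum_cong) (simp add: mult_smult_assoc_mat[OF pstr_carrier carrier[OF lt(2)]]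
        eigenvector lt mat_smult_smult)
  also have "\<dots> = (\<Sum>J\<in>K. \<epsilon> b J * \<epsilon> b' J) \<cdot>\<^sub>m \<phi> b'"
    by (rule msum_smult_const[OF carrier]) (rule lt)
  finally have "\<rho> b * \<phi> b' = z \<cdot>\<^sub>m \<phi> b'"
    unfolding \<rho>_def expansion[OF lt(1)] mult_smult_assoc_mat[OF msum_carrier carrier[OF lt(2)]]
    by (simp add: z_def mat_smult_smult)
  then have eq: "t \<cdot>\<^sub>m \<phi> b = z \<cdot>\<^sub>m \<phi> b'" using \<rho>_mult[OF lt] t_def by simp
  define s where "s = z / t"
  have \<phi>: "\<phi> b = s \<cdot>\<^sub>m \<phi> b'"
  proof -
    have "\<phi> b = (1 / t) \<cdot>\<^sub>m (t \<cdot>\<^sub>m \<phi> b)" using \<open>t \<noteq> 0\<close> by (simp add: mat_smult_smult mat_smult_one)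
    then show ?thesis unfolding eq mat_smult_smult by (simp add: s_def)
  qed
  have \<rho>: "\<rho> b = (s * cnj s) \<cdot>\<^sub>m \<rho> b'"
    unfolding \<rho>_def \<phi> dagger_smult
    using carrier[OF lt(2)] dagger_carrier_phi[OF lt(2)]
    by (simp add: mult_smult_distrib[of _ "2 ^ n" 1] mult_smult_assoc_mat[of _ "2 ^ n" 1]
        mat_smult_smult mult.commute)
  then have "tr (\<rho> b) = s * cnj s * tr (\<rho> b')" by (simp add: tr_smult[OF \<rho>_carrier[OF lt(2)]])
  \<comment> \<open>Both traces have the same nonzero value, so \<open>s\<close> is a phase and
    drops out of \<open>\<rho>\<close>.\<close>
  then have "s * cnj s = 1" using tr_\<rho>_eq[OF b] tr_\<rho>_eq[OF b'] tr_\<rho>_nonzero[OF b] by simp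
  then show "\<rho> b = \<rho> b'" using \<rho> by (simp add: mat_smult_one)
qed

text \<open>The index \<open>b'\<close> may also have \<open>\<phi> b' = 0\<close>, so that the
  formula can be summed against completeness. The nonzero value is a square because
  \<open>\<rho> b\<close> has rank one.\<close>

lemma tr_\<rho>_mult_\<rho>:
  assumes b: "b \<in> B" and b': "b' < 2 ^ (n + m)"
  shows "tr (\<rho> b * \<rho> b') = (if \<rho> b' = \<rho> b then (tr (\<rho> b))\<^sup>2 else 0)"
proof -
  note lt = B_less[OF b]
  have mult: "\<rho> b * \<rho> c = tr (dagger (\<phi> b) * \<phi> c) \<cdot>\<^sub>m (\<phi> b * dagger (\<phi> c))" if "c < 2 ^ (n + m)" for c
  proof -
    have "\<rho> b * \<rho> c = \<rho> b * \<phi> c * dagger (\<phi> c)"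
      unfolding \<rho>_def[of c]
      by (rule assoc_mult_mat[OF \<rho>_carrier[OF lt] carrier[OF that] dagger_carrier_phi[OF that], symmetric])
    then show ?thesis
      unfolding \<rho>_mult[OF lt that] mult_smult_assoc_mat[OF carrier[OF lt] dagger_carrier_phi[OF that]] .
  qed
  have *: "\<phi> b * dagger (\<phi> b') \<in> carrier_mat (2 ^ n) (2 ^ n)"
    by (rule mult_carrier_mat[OF carrier[OF lt] dagger_carrier_phi[OF b']])
  show ?thesis
  proof (cases "\<rho> b' = \<rho> b")
    case True
    have "tr (\<rho> b * \<rho> b) = tr (\<rho> b) * tr (\<rho> b)"
      unfolding mult[OF lt] \<rho>_def[symmetric] tr_smult[OF \<rho>_carrier[OF lt]] tr_\<rho>[OF lt] ..
    then show ?thesis using True by (simp add: power2_eq_square)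
  next
    case False
    have "tr (\<rho> b * \<rho> b') = 0"
    proof (cases "b' \<in> B")
      case True
      then have "dagger (\<phi> b) * \<phi> b' = 0\<^sub>m 1 1" using parallel_or_orthogonal[OF b True] False by metis
      then show ?thesis unfolding mult[OF b'] tr_smult[OF *] by (simp add: tr_zero del: One_nat_def)
    next
      case False
      then show ?thesis using \<rho>_carrier[OF lt] b' by (simp add: \<rho>_zero tr_zero)
    qed
    then show ?thesis using False by simp
  qed
qed

section \<open>Counting indices and strings\<close>

lemma card_class_complex:
  assumes b: "b \<in> B"
  shows "of_nat (card {b' \<in> B. \<rho> b' = \<rho> b}) * tr (\<rho> b) = 1"
proof -
  note lt = B_less[OF b]
  have eq: "{b'. b' < 2 ^ (n + m) \<and> \<rho> b' = \<rho> b} = {b' \<in> B. \<rho> b' = \<rho> b}"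
    using \<rho>_zero \<rho>_nonzero[OF b] by (auto simp: B_less)
  \<comment> \<open>Completeness inserts the identity, and only the class of \<open>b\<close>
    contributes to the resulting sum. Cancelling one factor of the nonzero trace then gives the
    claim.\<close>
  have "tr (\<rho> b) = tr (\<rho> b * msum (2 ^ n) (2 ^ n) \<rho> {..<2 ^ (n + m)})"
    using \<rho>_carrier[OF lt] complete unfolding \<rho>_def[symmetric] by simp
  also have "\<dots> = (\<Sum>b'<2 ^ (n + m). tr (\<rho> b * \<rho> b'))"
    using \<rho>_carrier[OF lt] \<rho>_carrier
    by (subst mult_msum, auto intro!: tr_msum mult_carrier_mat)
  also have "\<dots> = (\<Sum>b'<2 ^ (n + m). if \<rho> b' = \<rho> b then (tr (\<rho> b))\<^sup>2 else 0)"
    by (rule sum.cong) (simp_all add: tr_\<rho>_mult_\<rho>[OF b])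
  also have "\<dots> = of_nat (card {b' \<in> B. \<rho> b' = \<rho> b}) * (tr (\<rho> b))\<^sup>2"
    unfolding eq[symmetric] by (simp flip: sum.inter_filter)
  finally show ?thesis using tr_\<rho>_nonzero[OF b] by (simp add: power2_eq_square)
qed

lemma card_class: "b \<in> B \<Longrightarrow> card {b' \<in> B. \<rho> b' = \<rho> b} * card T = 2 ^ m"
proof -
  assume b: "b \<in> B"
  have "of_nat (card {b' \<in> B. \<rho> b' = \<rho> b} * card T) = (of_nat (2 ^ m) :: complex)"
    using card_class_complex[OF b] tr_\<rho>_eq[OF b] by (simp add: field_simps)
  then show ?thesis unfolding of_nat_eq_iff .
qed

text \<open>The trace of the completeness relation: each index in \<open>B\<close> contributes
  \<open>card T / 2 ^ m\<close>, the others nothing.\<close>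

lemma card_B: "card B * card T = 2 ^ (n + m)"
proof -
  have "(2::complex) ^ n = (\<Sum>b<2 ^ (n + m). tr (\<rho> b))"
    using arg_cong[OF complete, of tr] tr_msum[of "{..<2 ^ (n + m)}" \<rho> "2 ^ n"] \<rho>_carrier
    unfolding \<rho>_def[symmetric] by (simp add: tr_one)
  also have "\<dots> = (\<Sum>b\<in>B. tr (\<rho> b))"
    by (rule sum.mono_neutral_right) (auto simp: B_less \<rho>_zero tr_zero)
  also have "\<dots> = of_nat (card B) * (of_nat (card T) / 2 ^ m)" by (simp add: tr_\<rho>_eq)
  finally have "of_nat (card B * card T) = (of_nat (2 ^ (n + m)) :: complex)"
    by (simp add: field_simps power_add)
  then show ?thesis unfolding of_nat_eq_iff .
qed

text \<open>\<open>card T\<close> divides \<open>2 ^ m\<close> by \<open>card_class\<close>, so it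
  is a power of two; its exponent is the integer \<open>l\<close> of the result.\<close>

lemma card_T:
  obtains l where "l \<le> m" "card T = 2 ^ l" "card B = 2 ^ (n + m - l)"
    "\<And>b. b \<in> B \<Longrightarrow> card {b' \<in> B. \<rho> b' = \<rho> b} = 2 ^ (m - l)"
    "\<And>b. b \<in> B \<Longrightarrow> 2 ^ (m - l) * tr (\<rho> b) = 1"
proof -
  have "B \<noteq> {}" using card_B by auto
  then obtain b where b: "b \<in> B" by blast
  have "card T dvd 2 ^ m" using card_class[OF b] by (metis dvd_triv_right)
  then obtain l where l: "l \<le> m" "card T = 2 ^ l"
    using divides_primepow_nat[OF two_is_prime_nat] by blast
  have cancel: "x = 2 ^ (k - l)" if "x * card T = 2 ^ k" "l \<le> k" for x k :: nat
  proof -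
    have "x * 2 ^ l = 2 ^ (k - l) * 2 ^ l" using that l(2) by (simp flip: power_add)
    then show ?thesis by simp
  qed
  have fiber: "card {b' \<in> B. \<rho> b' = \<rho> b} = 2 ^ (m - l)" if "b \<in> B" for b
    using cancel[OF card_class[OF that] l(1)] .
  show thesis
  proof (rule that[OF l])
    show "card B = 2 ^ (n + m - l)" using cancel[OF card_B] l(1) by simp
    show "2 ^ (m - l) * tr (\<rho> b) = 1" if "b \<in> B" for b
      using card_class_complex[OF that] fiber[OF that] by simp
  qed (rule fiber)
qed

text \<open>The trace of the square of a nonzero \<open>\<rho> b\<close> is computed twice: as the
  square of its trace, by rank one, and through the expansion, where every string contributes the
  same amount.\<close>

lemma card_K: "card K = 2 ^ n * card T"
proof -
  have "B \<noteq> {}" using card_B by auto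
  then obtain b where b: "b \<in> B" by blast
  have "tr (\<rho> b * (\<phi> b * dagger (\<phi> b))) =
      (1 / 2 ^ (n + m)) * (\<Sum>J\<in>K. \<epsilon> b J * tr (\<rho> b * pstr n (P J)))"
    unfolding expansion[OF B_less[OF b]]
    by (rule tr_mult_smult_msum[OF \<rho>_carrier[OF B_less[OF b]]]) simp
  then have "(tr (\<rho> b))\<^sup>2 = (1 / 2 ^ (n + m)) * (\<Sum>J\<in>K. \<epsilon> b J * tr (\<rho> b * pstr n (P J)))"
    unfolding \<rho>_def[symmetric] tr_\<rho>_mult_\<rho>[OF b B_less[OF b]] by simp
  also have "(\<Sum>J\<in>K. \<epsilon> b J * tr (\<rho> b * pstr n (P J))) = (\<Sum>J\<in>K. tr (\<rho> b))"
  proof (rule sum.cong)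
    fix J assume J: "J \<in> K"
    have "tr (\<rho> b * pstr n (P J)) = \<epsilon> b J * tr (\<rho> b)"
      using tr_mult_commute[OF \<rho>_carrier[OF B_less[OF b]] pstr_carrier]
        tr_pstr_mult_\<rho>_eigenvalue[OF B_less[OF b] J] by simp
    then show "\<epsilon> b J * tr (\<rho> b * pstr n (P J)) = tr (\<rho> b)"
      using eigenvalue_square[OF b J] by (simp flip: mult.assoc)
  qed simp
  finally have "tr (\<rho> b) * tr (\<rho> b) = of_nat (card K) / 2 ^ (n + m) * tr (\<rho> b)"
    by (simp add: power2_eq_square)
  then have "tr (\<rho> b) = of_nat (card K) / 2 ^ (n + m)"
    using tr_\<rho>_nonzero[OF b] unfolding mult_cancel_right by blast
  then have "of_nat (card K) = (of_nat (2 ^ n * card T) :: complex)"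
    using tr_\<rho>_eq[OF b] by (simp add: field_simps power_add)
  then show ?thesis unfolding of_nat_eq_iff .
qed

text \<open>Labels are set to zero from \<open>n\<close> on, so that equality of labels is equality
  of strings and the cardinality counts strings.\<close>

definition strings :: "(nat \<Rightarrow> pauli1) set" where
  "strings = (\<lambda>J i. if i < n then P J i else 0) ` K"

text \<open>Every surviving string occurs exactly \<open>card T\<close> times in \<open>K\<close>,
  so \<open>card_K\<close> leaves \<open>2 ^ n\<close> distinct ones.\<close>

lemma card_strings: "card strings = 2 ^ n"
proof -
  have "B \<noteq> {}" using card_B by auto
  then obtain b where b: "b \<in> B" by blast
  note lt = B_less[OF b]
  let ?r = "\<lambda>J i. if i < n then P J i else 0"
  have fiber: "card {J \<in> K. ?r J = a} = card T" if a: "a \<in> strings" for a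
  proof -
    from a obtain J0 where J0: "J0 \<in> K" "a = ?r J0" by (auto simp: strings_def)
    have eq: "{J \<in> K. ?r J = a} = {J \<in> K. \<forall>i<n. P J i = P J0 i}"
      by (auto simp: J0(2) fun_eq_iff)
    \<comment> \<open>The pairing with the string of \<open>J0\<close>, evaluated by eigenvalue on
      the left and by expansion on the right; all indices of the fiber carry the same sign.\<close>
    have "\<epsilon> b J0 * tr (\<rho> b) = (\<Sum>J\<in>{J \<in> K. ?r J = a}. \<epsilon> b J) / 2 ^ m"
      using tr_pstr_mult_\<rho>_eigenvalue[OF lt J0(1)] tr_pstr_mult_\<rho>_expansion[OF lt, of "P J0"]
      by (simp only: eq)
    also have "(\<Sum>J\<in>{J \<in> K. ?r J = a}. \<epsilon> b J) = (\<Sum>J\<in>{J \<in> K. ?r J = a}. \<epsilon> b J0)"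
      unfolding eq by (intro sum.cong refl eigenvalue_cong[OF b _ J0(1)]) auto
    finally have "\<epsilon> b J0 * of_nat (card T) = \<epsilon> b J0 * (of_nat (card {J \<in> K. ?r J = a}) :: complex)"
      using tr_\<rho>_eq[OF b] by (simp add: field_simps)
    moreover have "\<epsilon> b J0 \<noteq> 0" using eigenvalue_square[OF b J0(1)] by auto
    ultimately show ?thesis by simp
  qed
  have "card T * card strings = card K"
    unfolding strings_def using fiber[unfolded strings_def] finite_K
    by (subst card_eq_sum[of K], subst sum.image_gen[OF finite_K, of _ ?r]) simp
  then have "card T * card strings = card T * 2 ^ n" using card_K by (simp add: mult.commute)
  moreover have "card T \<noteq> 0" using card_B by (metis mult_0_right power_not_zero zero_neq_numeral)
  ultimately show ?thesis by simp
qed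

section \<open>Assembling the stabilizer basis\<close>

lemma strings_commute:
  assumes "J \<in> K" "J' \<in> K"
  shows "pstr n (P J) * pstr n (P J') = pstr n (P J') * pstr n (P J)"
proof -
  let ?M = "\<lambda>J. pstr n (P J)"
  have car: "?M J * ?M J' \<in> carrier_mat (2 ^ n) (2 ^ n)" for J J'
    by (rule mult_carrier_mat[OF pstr_carrier pstr_carrier])
  have "?M J * ?M J' * \<rho> b = (\<epsilon> b J * \<epsilon> b J') \<cdot>\<^sub>m \<rho> b"
    if "J \<in> K" "J' \<in> K" "b < 2 ^ (n + m)" for J J' b
  proof -
    note c = carrier[OF that(3)] dagger_carrier_phi[OF that(3)]
    have "?M J * ?M J' * \<phi> b = (\<epsilon> b J * \<epsilon> b J') \<cdot>\<^sub>m \<phi> b"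
      unfolding assoc_mult_mat[OF pstr_carrier pstr_carrier c(1)] eigenvector[OF that(3,2)]
        mult_smult_distrib[OF pstr_carrier c(1)] eigenvector[OF that(3,1)] mat_smult_smult
      by (simp add: mult.commute)
    then show ?thesis
      using assoc_mult_mat[OF car c, of J J'] mult_smult_assoc_mat[OF c] by (simp add: \<rho>_def)
  qed
  \<comment> \<open>On each \<open>\<rho> b\<close> both products act by the same scalar; summing
    over \<open>b\<close> recovers the products themselves by completeness.\<close>
  then have "msum (2 ^ n) (2 ^ n) (\<lambda>b. ?M J * ?M J' * \<rho> b) {..<2 ^ (n + m)} =
      msum (2 ^ n) (2 ^ n) (\<lambda>b. ?M J' * ?M J * \<rho> b) {..<2 ^ (n + m)}"
    using assms by (intro msum_cong) (simp add: mult.commute)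
  moreover have "msum (2 ^ n) (2 ^ n) (\<lambda>b. M * \<rho> b) {..<2 ^ (n + m)} = M"
    if "M \<in> carrier_mat (2 ^ n) (2 ^ n)" for M
  proof -
    have "M * msum (2 ^ n) (2 ^ n) \<rho> {..<2 ^ (n + m)} = msum (2 ^ n) (2 ^ n) (\<lambda>b. M * \<rho> b) {..<2 ^ (n + m)}"
      using that \<rho>_carrier by (intro mult_msum) auto
    then show ?thesis using complete that unfolding \<rho>_def by simp
  qed
  ultimately show ?thesis using car by simp
qed

text \<open>One vector from each class of parallel vectors is rescaled to norm one by the real
  square root \<open>s\<close> of \<open>t\<close>. The generators are \<open>n\<close> independent
  members of \<open>strings\<close>, which exist because there are \<open>2 ^ n\<close> of
  them.\<close>

lemma stabilizer_basis_of_classes: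
  assumes h: "bij_betw h {..<2 ^ n} (\<rho> ` B)"
    and r: "\<And>c. c < 2 ^ n \<Longrightarrow> r c \<in> B \<and> \<rho> (r c) = h c"
    and t: "\<And>b. b \<in> B \<Longrightarrow> t * tr (\<rho> b) = 1" and s: "s * s = t" "cnj s = s"
  shows "stabilizer_basis n (\<lambda>c. s \<cdot>\<^sub>m \<phi> (r c))"
proof -
  have lt: "r c < 2 ^ (n + m)" if "c < 2 ^ n" for c using r[OF that] B_less by blast
  note car = carrier[OF lt] dagger_carrier_phi[OF lt]
  have gram: "dagger (s \<cdot>\<^sub>m \<phi> (r c)) * (s \<cdot>\<^sub>m \<phi> (r c')) = t \<cdot>\<^sub>m (dagger (\<phi> (r c)) * \<phi> (r c'))"
    if "c < 2 ^ n" "c' < 2 ^ n" for c c'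
    unfolding dagger_smult s(2) mult_smult_assoc_mat[OF car(2)[OF that(1)] smult_carrier_mat[OF car(1)[OF that(2)]]]
      mult_smult_distrib[OF car(2)[OF that(1)] car(1)[OF that(2)]] mat_smult_smult s(1) ..
  have orth: "t \<cdot>\<^sub>m (dagger (\<phi> (r c)) * \<phi> (r c')) = (if c = c' then 1\<^sub>m 1 else 0\<^sub>m 1 1)"
    if c: "c < 2 ^ n" "c' < 2 ^ n" for c c'
  proof (cases "c = c'")
    case True
    have "dagger (\<phi> (r c)) * \<phi> (r c) = tr (\<rho> (r c)) \<cdot>\<^sub>m 1\<^sub>m 1"
      unfolding tr_\<rho>[OF lt[OF c(1)]]
      by (rule tr_one_dim[OF mult_carrier_mat[OF car(2)[OF c(1)] car(1)[OF c(1)]]])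
    then show ?thesis using True t[of "r c"] r[OF c(1)] by (simp add: mat_smult_smult mat_smult_one)
  next
    case False
    then have "h c \<noteq> h c'"
      using h c unfolding bij_betw_def inj_on_def by (metis lessThan_iff)
    then have "dagger (\<phi> (r c)) * \<phi> (r c') = 0\<^sub>m 1 1"
      using parallel_or_orthogonal[of "r c" "r c'"] r c by metis
    then show ?thesis using False by simp
  qed
  have "finite strings" using finite_K by (simp add: strings_def)
  from exists_independent_family[OF this _ pauli1_fun_double, of n]
  obtain a where a: "\<And>j. j < n \<Longrightarrow> a j \<in> strings"
    and ind: "\<And>J. J \<subseteq> {..<n} \<Longrightarrow> sum a J = 0 \<Longrightarrow> J = {}"
    using card_strings by auto
  have "\<exists>J\<in>K. a j = (\<lambda>i. if i < n then P J i else 0)" if "j < n" for j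
    using a[OF that] by (auto simp: strings_def)
  then obtain x where x: "\<And>j. j < n \<Longrightarrow> x j \<in> K"
    "\<And>j. j < n \<Longrightarrow> a j = (\<lambda>i. if i < n then P (x j) i else 0)"
    by metis
  have g: "pstr n (a j) = pstr n (P (x j))" if "j < n" for j
    using x(2)[OF that] by (intro pstr_cong) simp
  have gens: "pstr n (a j) = \<i> ^ 0 \<cdot>\<^sub>m pstr n (a j)" for j
    by (simp add: mat_smult_one)
  have "J = {}" if J: "J \<subseteq> {..<n}" "\<forall>i<n. (\<Sum>j\<in>J. a j) i = 0" for J
  proof -
    \<comment> \<open>Members of \<open>strings\<close> vanish from \<open>n\<close> on, so a sum
      vanishing below \<open>n\<close> is zero as a function, as \<open>ind\<close> demands.\<close>
    have "(\<Sum>j\<in>J. a j) i = 0" if "\<not> i < n" for i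
      unfolding sum_fun_apply using J(1) x(2) that by (intro sum.neutral) auto
    then have "(\<Sum>j\<in>J. a j) = 0" using J(2) by (intro ext) (metis zero_fun_apply)
    then show ?thesis by (rule ind[OF J(1)])
  qed
  then have "independent_paulis n (\<lambda>j. pstr n (a j))"
    using independent_paulis_pstr[of n "\<lambda>j. pstr n (a j)" "\<lambda>_. 0" a, OF gens] by blast
  moreover have "pstr n (a j) \<in> pauli_group n" for j
    unfolding pauli_group_iff using gens by blast
  moreover have "pstr n (a i) * pstr n (a j) = pstr n (a j) * pstr n (a i)" if "i < n" "j < n" for i j
    using strings_commute[OF x(1)[OF that(1)] x(1)[OF that(2)]] g that by simp
  moreover have "\<exists>e. pstr n (a j) * (s \<cdot>\<^sub>m \<phi> (r c)) = e \<cdot>\<^sub>m (s \<cdot>\<^sub>m \<phi> (r c))"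
    if "c < 2 ^ n" "j < n" for c j
    unfolding g[OF that(2)] mult_smult_distrib[OF pstr_carrier car(1)[OF that(1)]]
      eigenvector[OF lt[OF that(1)] x(1)[OF that(2)]] mat_smult_smult
    by (metis mult.commute)
  ultimately show ?thesis
    unfolding stabilizer_basis_def
    using gram orth car(1) by (intro conjI exI[of _ "\<lambda>j. pstr n (a j)"]) auto
qed

text \<open>The factor \<open>1 / 2 ^ (m - l)\<close> is the common trace of the nonzero
  \<open>\<rho> b\<close>; the truncated subtraction is exact because
  \<open>l \<le> m\<close>.\<close>

lemma measurement_structure:
  "\<exists>l\<le>m. card {b. b < 2 ^ (n + m) \<and> \<rho> b \<noteq> 0\<^sub>m (2 ^ n) (2 ^ n)} = 2 ^ (n + m - l) \<and>
     (\<exists>\<Psi>. stabilizer_basis n \<Psi> \<and>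
        (\<forall>b<2 ^ (n + m). \<rho> b \<noteq> 0\<^sub>m (2 ^ n) (2 ^ n) \<longrightarrow>
            (\<exists>c<2 ^ n. \<rho> b = (1 / 2 ^ (m - l)) \<cdot>\<^sub>m (\<Psi> c * dagger (\<Psi> c)))) \<and>
        (\<forall>c<2 ^ n. card {b. b < 2 ^ (n + m) \<and>
            \<rho> b = (1 / 2 ^ (m - l)) \<cdot>\<^sub>m (\<Psi> c * dagger (\<Psi> c))} = 2 ^ (m - l)))"
proof -
  obtain l where l: "l \<le> m" "card T = 2 ^ l" "card B = 2 ^ (n + m - l)"
    and fiber: "\<And>b. b \<in> B \<Longrightarrow> card {b' \<in> B. \<rho> b' = \<rho> b} = 2 ^ (m - l)"
    and t: "\<And>b. b \<in> B \<Longrightarrow> 2 ^ (m - l) * tr (\<rho> b) = 1"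
    by (rule card_T) (rule that)
  have B: "{b. b < 2 ^ (n + m) \<and> \<rho> b \<noteq> 0\<^sub>m (2 ^ n) (2 ^ n)} = B"
    using \<rho>_zero \<rho>_nonzero B_less by blast
  \<comment> \<open>\<open>B\<close> splits into fibers of \<open>\<rho>\<close> of equal size
    \<open>2 ^ (m - l)\<close>, which leaves \<open>2 ^ n\<close> distinct values.\<close>
  have "card B = (\<Sum>q\<in>\<rho> ` B. card {b \<in> B. \<rho> b = q})"
    using sum.image_gen[OF finite_B, of "\<lambda>_. 1::nat" \<rho>] by simp
  also have "\<dots> = (\<Sum>q\<in>\<rho> ` B. 2 ^ (m - l))"
    by (rule sum.cong) (auto simp: fiber)
  finally have "card (\<rho> ` B) * 2 ^ (m - l) = (2::nat) ^ n * 2 ^ (m - l)"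
    using l by (simp flip: power_add)
  then have "card (\<rho> ` B) = 2 ^ n" by simp
  then obtain h where h: "bij_betw h {..<(2::nat) ^ n} (\<rho> ` B)"
    using ex_bij_betw_nat_finite[of "\<rho> ` B"] finite_B by (auto simp: lessThan_atLeast0)
  have "\<forall>c<2 ^ n. \<exists>b\<in>B. \<rho> b = h c"
    using h by (metis bij_betwE imageE lessThan_iff)
  then obtain r where r: "\<And>c. c < 2 ^ n \<Longrightarrow> r c \<in> B \<and> \<rho> (r c) = h c" by metis
  \<comment> \<open>A nonzero \<open>\<phi> b\<close> has squared norm
    \<open>1 / 2 ^ (m - l)\<close>, so this factor normalises it.\<close>
  define s :: complex where "s = of_real (sqrt (2 ^ (m - l)))"
  have s: "s * s = 2 ^ (m - l)" "cnj s = s"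
    by (simp_all add: s_def flip: of_real_mult)
  have \<Psi>: "(1 / 2 ^ (m - l)) \<cdot>\<^sub>m (s \<cdot>\<^sub>m \<phi> (r c) * dagger (s \<cdot>\<^sub>m \<phi> (r c))) = h c" if c: "c < 2 ^ n" for c
  proof -
    note lt = B_less[OF conjunct1[OF r[OF c]]]
    have "s \<cdot>\<^sub>m \<phi> (r c) * dagger (s \<cdot>\<^sub>m \<phi> (r c)) = (s * s) \<cdot>\<^sub>m \<rho> (r c)"
      unfolding dagger_smult s(2) mult_smult_distrib[OF smult_carrier_mat[OF carrier[OF lt]] dagger_carrier_phi[OF lt]]
        mult_smult_assoc_mat[OF carrier[OF lt] dagger_carrier_phi[OF lt]] mat_smult_smult \<rho>_def ..
    then show ?thesis using r[OF c] by (simp add: s(1) mat_smult_smult mat_smult_one)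
  qed
  have "\<exists>c<2 ^ n. \<rho> b = (1 / 2 ^ (m - l)) \<cdot>\<^sub>m (s \<cdot>\<^sub>m \<phi> (r c) * dagger (s \<cdot>\<^sub>m \<phi> (r c)))"
    if "b < 2 ^ (n + m)" "\<rho> b \<noteq> 0\<^sub>m (2 ^ n) (2 ^ n)" for b
  proof -
    have "\<rho> b \<in> \<rho> ` B" using that \<rho>_zero by blast
    then obtain c where "c < 2 ^ n" "\<rho> b = h c"
      using h unfolding bij_betw_def by (metis imageE lessThan_iff)
    then show ?thesis using \<Psi> by auto
  qed
  moreover have "card {b. b < 2 ^ (n + m) \<and> \<rho> b = h c} = 2 ^ (m - l)" if c: "c < 2 ^ n" for c
  proof -
    \<comment> \<open>Since \<open>h c\<close> is nonzero, counting over all indices agrees with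
      counting over \<open>B\<close>.\<close>
    have "{b. b < 2 ^ (n + m) \<and> \<rho> b = h c} = {b \<in> B. \<rho> b = \<rho> (r c)}"
      using r[OF c] \<rho>_zero \<rho>_nonzero[of "r c"] by (auto simp: B_less)
    then show ?thesis using fiber[of "r c"] r[OF c] by simp
  qed
  ultimately show ?thesis
    using l stabilizer_basis_of_classes[OF h r t s] B
    by (intro exI[of _ l] conjI exI[of _ "\<lambda>c. s \<cdot>\<^sub>m \<phi> (r c)"]) (auto simp: \<Psi>)
qed

end

section \<open>Compression of a stabilizer basis by a stabilizer state\<close>

theorem theorem2:
  fixes n m :: nat and \<Phi> :: "nat \<Rightarrow> complex mat" and \<psi> :: "complex mat"
    and \<mu> :: "nat \<Rightarrow> complex mat"
  assumes "stabilizer_basis (n + m) \<Phi>"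
    and "stabilizer_state m \<psi>"
    and "\<And>b. \<mu> b = kron (1\<^sub>m (2^n)) (dagger \<psi>) * \<Phi> b * dagger (\<Phi> b) * kron (1\<^sub>m (2^n)) \<psi>"
  shows "\<exists>l::nat. l \<le> m \<and>
     card {b. b < 2^(n+m) \<and> \<mu> b \<noteq> 0\<^sub>m (2^n) (2^n)} = 2^(n + m - l) \<and>
     (\<exists>\<Psi>. stabilizer_basis n \<Psi> \<and>
        (\<forall>b<2^(n+m). \<mu> b \<noteq> 0\<^sub>m (2^n) (2^n) \<longrightarrow>
            (\<exists>c<2^n. \<mu> b = (1 / 2^(m - l)) \<cdot>\<^sub>m (\<Psi> c * dagger (\<Psi> c)))) \<and>
        (\<forall>c<2^n. card {b. b < 2^(n+m) \<and>
            \<mu> b = (1 / 2^(m - l)) \<cdot>\<^sub>m (\<Psi> c * dagger (\<Psi> c))} = 2^(m - l)))"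
proof -
  let ?N = "2 ^ (n + m) :: nat"
  define W where "W = kron (1\<^sub>m (2 ^ n)) (dagger \<psi>)"
  note W = bra_isometry[of m \<psi> n, folded W_def]
  have "is_state m \<psi>" using assms(2) by (simp add: stabilizer_state_def)
  note W = W[OF this]
  have dWc: "dagger W \<in> carrier_mat ?N (2 ^ n)" using W(1) by simp
  have dW: "dagger W = kron (1\<^sub>m (2 ^ n)) \<psi>" by (simp add: W_def dagger_kron)
  have car: "\<Phi> b \<in> carrier_mat ?N 1" if "b < ?N" for b
    using assms(1) that by (simp add: stabilizer_basis_def)
  have orth: "dagger (\<Phi> b) * \<Phi> c = (if b = c then 1\<^sub>m 1 else 0\<^sub>m 1 1)" if "b < ?N" "c < ?N" for b c
    using assms(1) that unfolding stabilizer_basis_def by blast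
  obtain A where A:
    "\<And>J J'. J \<subseteq> {..<n + m} \<Longrightarrow> J' \<subseteq> {..<n + m} \<Longrightarrow> (\<forall>i<n + m. A J i = A J' i) \<Longrightarrow> J = J'"
    "\<And>J b. J \<subseteq> {..<n + m} \<Longrightarrow> b < ?N \<Longrightarrow> \<exists>e. pstr (n + m) (A J) * \<Phi> b = e \<cdot>\<^sub>m \<Phi> b"
    using stabilizer_basis_pstr[OF assms(1)] by blast
  define Q where "Q J = pstr (n + m) (A J)" for J
  have Q: "Q J \<in> carrier_mat ?N ?N" for J by (simp add: Q_def)
  have "\<forall>b J. \<exists>e. b < ?N \<longrightarrow> J \<subseteq> {..<n + m} \<longrightarrow> Q J * \<Phi> b = e \<cdot>\<^sub>m \<Phi> b"
    using A(2) Q_def by metis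
  then obtain e where e: "\<And>b J. b < ?N \<Longrightarrow> J \<subseteq> {..<n + m} \<Longrightarrow> Q J * \<Phi> b = e b J \<cdot>\<^sub>m \<Phi> b"
    by metis
  \<comment> \<open>The generator products with nonzero compression; by \<open>bra_pstr\<close> each
    of them passes through \<open>W\<close> with a sign.\<close>
  define K where "K = {J \<in> Pow {..<n + m}. W * Q J * dagger W \<noteq> 0\<^sub>m (2 ^ n) (2 ^ n)}"
  have "\<forall>J. \<exists>z. J \<in> K \<longrightarrow> z * z = 1 \<and> W * Q J = z \<cdot>\<^sub>m (pstr n (A J) * W)"
    using bra_pstr[OF assms(2), of n, folded W_def] by (auto simp: K_def Q_def)
  then obtain z where z: "\<And>J. J \<in> K \<Longrightarrow> z J * z J = 1"
      "\<And>J. J \<in> K \<Longrightarrow> W * Q J = z J \<cdot>\<^sub>m (pstr n (A J) * W)"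
    by metis
  define \<phi> where "\<phi> b = W * \<Phi> b" for b
  \<comment> \<open>Passing through \<open>W\<close> multiplies both the eigenvalue and the
    expansion coefficient by \<open>z J\<close>.\<close>
  define \<epsilon> where "\<epsilon> b J = e b J * z J" for b J
  have \<phi>: "\<phi> b * dagger (\<phi> b) = W * (\<Phi> b * dagger (\<Phi> b)) * dagger W" if b: "b < ?N" for b
  proof -
    have d: "dagger (\<Phi> b) \<in> carrier_mat 1 ?N" using car[OF b] by simp
    show ?thesis
      unfolding \<phi>_def dagger_mult[OF W(1) car[OF b]]
        assoc_mult_mat[OF mult_carrier_mat[OF W(1) car[OF b]] d dWc, symmetric]
        assoc_mult_mat[OF W(1) car[OF b] d] ..
  qed
  have \<mu>: "\<mu> b = \<phi> b * dagger (\<phi> b)" if b: "b < ?N" for b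
  proof -
    have d: "dagger (\<Phi> b) \<in> carrier_mat 1 ?N" using car[OF b] by simp
    show ?thesis
      unfolding assms(3) W_def[symmetric] dW[symmetric] \<phi>[OF b] assoc_mult_mat[OF W(1) car[OF b] d] ..
  qed
  \<comment> \<open>\<open>A J\<close> serves as the data label without change, because
    \<open>pstr n\<close> reads only its first \<open>n\<close> values.\<close>
  interpret pauli_frame n m \<phi> K A \<epsilon>
  proof
    fix b J assume b: "b < ?N"
    show \<phi>b: "\<phi> b \<in> carrier_mat (2 ^ n) 1"
      unfolding \<phi>_def by (rule mult_carrier_mat[OF W(1) car[OF b]])
    {
      assume J: "J \<in> K"
      then have J': "J \<subseteq> {..<n + m}" by (simp add: K_def)
      have "z J \<cdot>\<^sub>m (pstr n (A J) * \<phi> b) = W * Q J * \<Phi> b"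
        unfolding z(2)[OF J] \<phi>_def
          mult_smult_assoc_mat[OF mult_carrier_mat[OF pstr_carrier W(1)] car[OF b]]
          assoc_mult_mat[OF pstr_carrier W(1) car[OF b]] ..
      also have "\<dots> = e b J \<cdot>\<^sub>m \<phi> b"
        unfolding assoc_mult_mat[OF W(1) Q car[OF b]] e[OF b J'] \<phi>_def
        by (rule mult_smult_distrib[OF W(1) car[OF b]])
      finally have "z J \<cdot>\<^sub>m (z J \<cdot>\<^sub>m (pstr n (A J) * \<phi> b)) = z J \<cdot>\<^sub>m (e b J \<cdot>\<^sub>m \<phi> b)" by simp
      then show "pstr n (A J) * \<phi> b = \<epsilon> b J \<cdot>\<^sub>m \<phi> b"
        unfolding mat_smult_smult z(1)[OF J] \<epsilon>_def by (simp add: mat_smult_one mult.commute)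
    }
    have unit: "dagger (\<Phi> b) * \<Phi> b = 1\<^sub>m 1" using orth[OF b b] by simp
    have "\<Phi> b * dagger (\<Phi> b) = (1 / 2 ^ (n + m)) \<cdot>\<^sub>m
        msum ?N ?N (\<lambda>J. e b J \<cdot>\<^sub>m Q J) (Pow {..<n + m})"
      unfolding Q_def
      by (rule pstr_projector[OF car[OF b] unit])
        (use A(1) e[OF b] in \<open>simp_all add: Q_def card_Pow\<close>)
    then have "\<phi> b * dagger (\<phi> b) = W * ((1 / 2 ^ (n + m)) \<cdot>\<^sub>m
        msum ?N ?N (\<lambda>J. e b J \<cdot>\<^sub>m Q J) (Pow {..<n + m})) * dagger W"
      using \<phi>[OF b] by simp
    also have "\<dots> = (1 / 2 ^ (n + m)) \<cdot>\<^sub>m (W * msum ?N ?N (\<lambda>J. e b J \<cdot>\<^sub>m Q J) (Pow {..<n + m}) * dagger W)"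
      unfolding mult_smult_distrib[OF W(1) msum_carrier]
      by (rule mult_smult_assoc_mat[OF mult_carrier_mat[OF W(1) msum_carrier] dWc])
    also have "W * msum ?N ?N (\<lambda>J. e b J \<cdot>\<^sub>m Q J) (Pow {..<n + m}) * dagger W =
        msum (2 ^ n) (2 ^ n) (\<lambda>J. W * (e b J \<cdot>\<^sub>m Q J) * dagger W) (Pow {..<n + m})"
      using Q W(1) by (subst mult_msum[OF W(1)], simp, subst msum_mult[OF _ dWc])
        (auto intro: mult_carrier_mat)
    also have "\<dots> = msum (2 ^ n) (2 ^ n) (\<lambda>J. e b J \<cdot>\<^sub>m (W * Q J * dagger W)) (Pow {..<n + m})"
      by (simp add: mult_smult_distrib[OF W(1) Q] mult_smult_assoc_mat[OF mult_carrier_mat[OF W(1) Q] dWc])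
    \<comment> \<open>Terms outside \<open>K\<close> are multiples of the zero matrix.\<close>
    also have "\<dots> = msum (2 ^ n) (2 ^ n) (\<lambda>J. e b J \<cdot>\<^sub>m (W * Q J * dagger W)) K"
      unfolding msum_def
      by (rule cong_mat) (auto simp: K_def intro!: sum.mono_neutral_right)
    also have "\<dots> = msum (2 ^ n) (2 ^ n) (\<lambda>J. \<epsilon> b J \<cdot>\<^sub>m pstr n (A J)) K"
    proof (rule msum_cong)
      fix J assume J: "J \<in> K"
      have "W * Q J * dagger W = z J \<cdot>\<^sub>m pstr n (A J)"
        unfolding z(2)[OF J] mult_smult_assoc_mat[OF mult_carrier_mat[OF pstr_carrier W(1)] dWc]
          assoc_mult_mat[OF pstr_carrier W(1) dWc] W(2) right_mult_one_mat[OF pstr_carrier] ..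
      then show "e b J \<cdot>\<^sub>m (W * Q J * dagger W) = \<epsilon> b J \<cdot>\<^sub>m pstr n (A J)"
        by (simp add: mat_smult_smult \<epsilon>_def)
    qed
    finally show "\<phi> b * dagger (\<phi> b) =
        (1 / 2 ^ (n + m)) \<cdot>\<^sub>m msum (2 ^ n) (2 ^ n) (\<lambda>J. \<epsilon> b J \<cdot>\<^sub>m pstr n (A J)) K" .
  next
    show "finite K" by (simp add: K_def)
  next
    have "msum (2 ^ n) (2 ^ n) (\<lambda>b. \<phi> b * dagger (\<phi> b)) {..<?N} =
        msum (2 ^ n) (2 ^ n) (\<lambda>b. W * (\<Phi> b * dagger (\<Phi> b)) * dagger W) {..<?N}"
      by (rule msum_cong) (simp add: \<phi>)
    also have "\<dots> = W * msum ?N ?N (\<lambda>b. \<Phi> b * dagger (\<Phi> b)) {..<?N} * dagger W"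
    proof -
      have "\<Phi> b * dagger (\<Phi> b) \<in> carrier_mat ?N ?N" if "b < ?N" for b
        using mult_carrier_mat[OF car[OF that], of "dagger (\<Phi> b)" ?N] car[OF that] by simp
      then show ?thesis using W(1)
        by (subst mult_msum[OF W(1)], simp, subst msum_mult[OF _ dWc]) (auto intro: mult_carrier_mat)
    qed
    \<comment> \<open>Orthonormality resolves the identity on all qubits; compressing it leaves
      \<open>W\<close> times its adjoint.\<close>
    also have "msum ?N ?N (\<lambda>b. \<Phi> b * dagger (\<Phi> b)) {..<?N} = 1\<^sub>m ?N"
      by (rule orthonormal_basis_complete[OF car orth])
    also have "W * 1\<^sub>m ?N * dagger W = 1\<^sub>m (2 ^ n)"
      using W by simp
    finally show "msum (2 ^ n) (2 ^ n) (\<lambda>b. \<phi> b * dagger (\<phi> b)) {..<?N} = 1\<^sub>m (2 ^ n)" .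
  qed
  have eq: "\<rho> b = \<mu> b" if "b < ?N" for b
    using \<mu>[OF that] by (simp add: \<rho>_def)
  show ?thesis
    using measurement_structure by (simp add: eq cong: conj_cong imp_cong)
qed

end
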